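(* Let $G$ be a connected, simply connected nilpotent Lie group with Lie algebra $\mathfrak g$, equipped with an integrable left-invariant horizontal CR structure of type $(n,k)$. Then $G$ admits a CR embedding $\iota$ into $\mathbb{C}^{n+k}$ of the form $$(\mathbf x + i\mathbf y, \mathbf t) \mapsto (\mathbf x + i\mathbf y + \mathbf p(\mathbf x,\mathbf y),\ \mathbf t + \mathbf q(\mathbf x,\mathbf y,\mathbf t)),$$ where $\mathbf x,\mathbf y\in\mathbb R^n$, $\mathbf t\in\mathbb R^k$, $\mathbf p(\mathbf x,\mathbf y)$ is a vector of $n$ (possibly complex-valued) polynomials, and $\mathbf q(\mathbf x,\mathbf y,\mathbf t)$ is a vector of $k$ (possibly complex-valued) polynomials.
   Context: A horizontal subspace of $\mathfrak g$ is a linear subspace $\mathfrak h$ that generates $\mathfrak g$ as a Lie algebra and admits a complementary ideal $\mathfrak n$, i.e. $\mathfrak g=\mathfrak h\oplus\mathfrak n$ as vector spaces with $\mathfrak n$ an ideal. An integrable left-invariant horizontal CR structure of type $(n,k)$ on $G$ consists of such a horizontal subspace $\mathfrak h$ with $\dim\mathfrak h=2n$, $\dim\mathfrak n=k$, together with a linear map $J:\mathfrak h\to\mathfrak h$ with $J^2=-\mathrm{id}$, satisfying the integrability condition $[X,JY]+[JX,Y]=J([X,Y]-[JX,JY])\in\mathfrak h$ for all $X,Y\in\mathfrak h$ (equivalently, $\mathfrak h^{01}=\{X+iJX: X\in\mathfrak h\}$ is a complex Lie subalgebra of $\mathfrak g_{\mathbb C}$). Left translation of $\mathfrak h$ and $J$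 gives a subbundle $HG\subset TG$ with almost complex structure; the $(0,1)$ vector fields are those spanned over functions by $\overleftarrow{X}+iJ\overleftarrow{X}$, $X\in\mathfrak h$, where $\overleftarrow{X}$ is the left-invariant vector field equal to $X$ at the identity. Points of $G$ are identified with $\mathbb R^{2n+k}$ via exponential coordinates $p=\exp(\sum_{j}x_jX_j)$ for a basis $X_1,\dots,X_{2n}$ of $\mathfrak h$ and $X_{2n+1},\dots,X_{2n+k}$ of $\mathfrak n$; $(\mathbf x,\mathbf y)\in\mathbb R^{2n}$ are the coordinates along $\mathfrak h$ and $\mathbf t\in\mathbb R^k$ those along $\mathfrak n$. A CR embedding is an embedding whose differential maps $(0,1)$ vector fields to $(0,1)$ vector fields (here of the standard complex structure of $\mathbb C^{n+k}$). *)

theory Defs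
  imports "HOL-Analysis.Analysis"
begin

text \<open>The simply connected Lie group G is modelled in exponential coordinates:
  its points are the elements of the Lie algebra g (a Euclidean space 'g), the
  exponential map is the identity, and the group law is a C1 map gmul on g x g
  such that every line through 0 is a one-parameter subgroup and the Lie bracket
  of G (computed from the group commutator) is br.\<close>

definition exp_coord_group :: "('g::euclidean_space \<Rightarrow> 'g \<Rightarrow> 'g) \<Rightarrow> ('g \<Rightarrow> 'g \<Rightarrow> 'g) \<Rightarrow> bool" where
  "exp_coord_group gmul br \<longleftrightarrow>
     (\<forall>x y z. gmul (gmul x y) z = gmul x (gmul y z)) \<and>
     (\<forall>x. gmul 0 x = x \<and> gmul x 0 = x) \<and>
     (\<forall>X s t. gmul (s *\<^sub>R X) (t *\<^sub>R X) = (s + t) *\<^sub>R X) \<and>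
     (\<exists>D. (\<forall>z. ((\<lambda>(x, y). gmul x y) has_derivative blinfun_apply (D z)) (at z))
          \<and> continuous_on UNIV D) \<and>
     (\<forall>X Y. ((\<lambda>s. (1 / s\<^sup>2) *\<^sub>R
                gmul (gmul (gmul (s *\<^sub>R X) (s *\<^sub>R Y)) (- (s *\<^sub>R X))) (- (s *\<^sub>R Y)))
             \<longlongrightarrow> br X Y) (at 0))"

fun lcs :: "('g::real_vector \<Rightarrow> 'g \<Rightarrow> 'g) \<Rightarrow> nat \<Rightarrow> 'g set" where
  "lcs br 0 = UNIV"
| "lcs br (Suc i) = span {br x y | x y. y \<in> lcs br i}"

definition nilpotent_lie :: "('g::real_vector \<Rightarrow> 'g \<Rightarrow> 'g) \<Rightarrow> bool" where
  "nilpotent_lie br \<longleftrightarrow> (\<exists>i. lcs br i = {0})"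

definition lie_generated :: "('g::real_vector \<Rightarrow> 'g \<Rightarrow> 'g) \<Rightarrow> 'g set \<Rightarrow> 'g set" where
  "lie_generated br S = \<Inter>{A. subspace A \<and> S \<subseteq> A \<and> (\<forall>x\<in>A. \<forall>y\<in>A. br x y \<in> A)}"

definition int_horizontal_CR ::
  "('g::euclidean_space \<Rightarrow> 'g \<Rightarrow> 'g) \<Rightarrow> 'g set \<Rightarrow> 'g set \<Rightarrow> ('g \<Rightarrow> 'g) \<Rightarrow> nat \<Rightarrow> nat \<Rightarrow> bool" where
  "int_horizontal_CR br h N J n k \<longleftrightarrow>
     subspace h \<and> subspace N \<and> h \<inter> N = {0} \<and> {x + y | x y. x \<in> h \<and> y \<in> N} = UNIV \<and>
     (\<forall>x y. y \<in> N \<longrightarrow> br x y \<in> N) \<and>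
     lie_generated br h = UNIV \<and>
     dim h = 2 * n \<and> dim N = k \<and>
     (\<forall>x\<in>h. \<forall>y\<in>h. \<forall>c::real. J (x + c *\<^sub>R y) = J x + c *\<^sub>R J y) \<and>
     (\<forall>x\<in>h. J x \<in> h \<and> J (J x) = - x) \<and>
     (\<forall>X\<in>h. \<forall>Y\<in>h. br X Y - br (J X) (J Y) \<in> h \<and>
        br X (J Y) + br (J X) Y = J (br X Y - br (J X) (J Y)))"

definition lvf :: "('g::euclidean_space \<Rightarrow> 'g \<Rightarrow> 'g) \<Rightarrow> 'g \<Rightarrow> 'g \<Rightarrow> 'g" where
  "lvf gmul X p = vector_derivative (\<lambda>s::real. gmul p (s *\<^sub>R X)) (at 0)"

text \<open>A map into C^m given by components iota j (j < m) is CR: its differential sends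
  the (0,1) fields lvf X + i lvf (J X) to (0,1) vectors, i.e. they annihilate each dz_j.\<close>
definition CR_map ::
  "('g::euclidean_space \<Rightarrow> 'g \<Rightarrow> 'g) \<Rightarrow> 'g set \<Rightarrow> ('g \<Rightarrow> 'g) \<Rightarrow> nat \<Rightarrow> (nat \<Rightarrow> 'g \<Rightarrow> complex) \<Rightarrow> bool" where
  "CR_map gmul h J m \<iota> \<longleftrightarrow>
     (\<forall>j<m. \<forall>p. \<forall>X\<in>h. \<exists>D. (\<iota> j has_derivative D) (at p) \<and>
        D (lvf gmul X p) + \<i> * D (lvf gmul (J X) p) = 0)"

definition embedding_Cm :: "nat \<Rightarrow> (nat \<Rightarrow> 'g::euclidean_space \<Rightarrow> complex) \<Rightarrow> bool" where
  "embedding_Cm m \<iota> \<longleftrightarrow>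
     (\<forall>p q. (\<forall>j<m. \<iota> j p = \<iota> j q) \<longrightarrow> p = q) \<and>
     (\<forall>j<m. \<forall>p. \<iota> j differentiable (at p)) \<and>
     (\<forall>p D. (\<forall>j<m. (\<iota> j has_derivative D j) (at p)) \<longrightarrow> (\<forall>v. (\<forall>j<m. D j v = 0) \<longrightarrow> v = 0)) \<and>
     (\<forall>(a::nat \<Rightarrow> 'g) p. (\<forall>j<m. (\<lambda>i. \<iota> j (a i)) \<longlonglongrightarrow> \<iota> j p) \<longrightarrow> a \<longlonglongrightarrow> p)"

inductive_set polyfun :: "nat set \<Rightarrow> ((nat \<Rightarrow> real) \<Rightarrow> complex) set" for V where
  const: "(\<lambda>c. a) \<in> polyfun V"
| var: "i \<in> V \<Longrightarrow> (\<lambda>c. complex_of_real (c i)) \<in> polyfun V"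
| add: "f \<in> polyfun V \<Longrightarrow> g \<in> polyfun V \<Longrightarrow> (\<lambda>c. f c + g c) \<in> polyfun V"
| mul: "f \<in> polyfun V \<Longrightarrow> g \<in> polyfun V \<Longrightarrow> (\<lambda>c. f c * g c) \<in> polyfun V"

end

theory Submission
  imports Defs
begin

text \<open>
  A flag of ideals of codimension one, refining \<open>N\<close> and with \<open>[g, F i] \<subseteq> F (i + 1)\<close>, makes the
  left-invariant fields polynomial and triangular, so they act on the polynomial functions as locally
  nilpotent derivations that represent \<open>g\<close>.  Call a step \<open>i\<close> skipped if some (0,1) vector lies in the
  complexified \<open>F i\<close> but not in \<open>F (i + 1)\<close>; each skipped step accounts for two real dimensions of
  \<open>h\<close>.  For the other steps the linear coordinate can be corrected to a CR polynomial by solving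
  \<open>\<partial>\<close>-bar equations one (0,1) vector at a time: at every stage a linear coordinate is a slice of the
  derivation in question, so the equation is solved by formal integration.  The same slice argument
  shows that these functions generate all CR polynomials, and that the CR polynomials and their
  conjugates generate all polynomials.  Hence the coordinates of \<open>G\<close> are polynomials in the components
  of the map and their conjugates, which gives injectivity, immersivity and the homeomorphism property
  at once.
\<close>

section \<open>Groups in exponential coordinates\<close>

lemma has_vector_derivative_translate:
  fixes g :: "real \<Rightarrow> 'b::real_normed_vector"
  assumes "((\<lambda>\<epsilon>. g (s + \<epsilon>)) has_vector_derivative d) (at 0)"
  shows "(g has_vector_derivative d) (at s)"
proof -
  have "((\<lambda>r. r - s) has_vector_derivative 1) (at s)"
    by (auto intro!: derivative_eq_intros)
  from vector_diff_chain_at[OF this] assms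
  have "((\<lambda>\<epsilon>. g (s + \<epsilon>)) \<circ> (\<lambda>r. r - s) has_vector_derivative 1 *\<^sub>R d) (at s)"
    by simp
  then show ?thesis by (simp add: o_def)
qed

lemma has_vector_derivative_at_0_iff:
  fixes g :: "real \<Rightarrow> 'b::real_normed_vector"
  shows "(g has_vector_derivative d) (at 0) \<longleftrightarrow> ((\<lambda>s. (g s - g 0) /\<^sub>R s) \<longlongrightarrow> d) (at 0)"
proof -
  have "((\<lambda>s. (g s - g 0) /\<^sub>R s) \<longlongrightarrow> d) (at 0) \<longleftrightarrow> ((\<lambda>s. norm ((g s - g 0) /\<^sub>R s - d)) \<longlongrightarrow> 0) (at 0)"
    by (simp add: LIM_zero_iff tendsto_norm_zero_iff)
  also have "\<dots> \<longleftrightarrow> ((\<lambda>s. norm (g s - g 0 - s *\<^sub>R d) / norm s) \<longlongrightarrow> 0) (at 0)"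
  proof (rule tendsto_cong, unfold eventually_at_filter, intro always_eventually allI impI)
    fix s :: real assume "s \<noteq> 0"
    then have "(g s - g 0) /\<^sub>R s - d = (g s - g 0 - s *\<^sub>R d) /\<^sub>R s"
      by (simp add: scaleR_diff_right)
    then show "norm ((g s - g 0) /\<^sub>R s - d) = norm (g s - g 0 - s *\<^sub>R d) / norm s"
      by (simp add: divide_inverse mult.commute)
  qed
  also have "\<dots> \<longleftrightarrow> (g has_vector_derivative d) (at 0)"
    by (simp add: has_vector_derivative_def has_derivative_iff_norm bounded_linear_scaleR_left)
  finally show ?thesis ..
qed

locale exp_group =
  fixes gmul :: "'g::euclidean_space \<Rightarrow> 'g \<Rightarrow> 'g" (infixl "\<star>" 70) and br :: "'g \<Rightarrow> 'g \<Rightarrow> 'g"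
  assumes exp_coord: "exp_coord_group (\<star>) br"
begin

lemma assoc: "x \<star> y \<star> z = x \<star> (y \<star> z)"
  using exp_coord by (simp add: exp_coord_group_def)

lemma gmul_0 [simp]: "0 \<star> x = x" "x \<star> 0 = x"
  using exp_coord by (simp_all add: exp_coord_group_def)

lemma one_param: "(s *\<^sub>R X) \<star> (t *\<^sub>R X) = (s + t) *\<^sub>R X"
  using exp_coord by (simp add: exp_coord_group_def)

lemma gmul_inv [simp]: "x \<star> (- x) = 0" "(- x) \<star> x = 0"
  using one_param[of 1 x "-1"] one_param[of "-1" x 1] by simp_all

lemma gmul_inv_assoc [simp]: "x \<star> ((- x) \<star> y) = y" "(- x) \<star> (x \<star> y) = y"
  by (simp_all flip: assoc)

lemma gmul_cancel_left: "x \<star> y = x \<star> z \<longleftrightarrow> y = z"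
  by (metis gmul_inv_assoc(2))

lemma commutator_lim:
  "((\<lambda>s. (1 / s\<^sup>2) *\<^sub>R ((s *\<^sub>R X) \<star> (s *\<^sub>R Y) \<star> (- (s *\<^sub>R X)) \<star> (- (s *\<^sub>R Y)))) \<longlongrightarrow> br X Y) (at 0)"
  using exp_coord unfolding exp_coord_group_def by blast

definition Dm :: "'g \<times> 'g \<Rightarrow> ('g \<times> 'g) \<Rightarrow>\<^sub>L 'g" where
  "Dm = (SOME D. (\<forall>z. ((\<lambda>(x, y). x \<star> y) has_derivative blinfun_apply (D z)) (at z)) \<and> continuous_on UNIV D)"

lemma Dm: "((\<lambda>(x, y). x \<star> y) has_derivative blinfun_apply (Dm z)) (at z)"
  and cont_Dm: "continuous_on UNIV Dm"
proof -
  have "\<exists>D. (\<forall>z. ((\<lambda>(x, y). x \<star> y) has_derivative blinfun_apply (D z)) (at z)) \<and> continuous_on UNIV D"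
    using exp_coord by (simp add: exp_coord_group_def)
  from someI_ex[OF this]
  show "((\<lambda>(x, y). x \<star> y) has_derivative blinfun_apply (Dm z)) (at z)" "continuous_on UNIV Dm"
    unfolding Dm_def by blast+
qed

lemma has_derivative_gmul:
  assumes "(f has_derivative f') (at x within S)" "(g has_derivative g') (at x within S)"
  shows "((\<lambda>x. f x \<star> g x) has_derivative (\<lambda>v. Dm (f x, g x) (f' v, g' v))) (at x within S)"
proof -
  have "((\<lambda>x. (\<lambda>(x, y). x \<star> y) (f x, g x)) has_derivative (\<lambda>v. Dm (f x, g x) (f' v, g' v))) (at x within S)"
    by (rule has_derivative_compose[OF has_derivative_Pair[OF assms] Dm])
  then show ?thesis by simp
qed

lemma has_vector_derivative_gmul:
  assumes "(f has_vector_derivative f') (at x within S)" "(g has_vector_derivative g') (at x within S)"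
  shows "((\<lambda>x. f x \<star> g x) has_vector_derivative Dm (f x, g x) (f', g')) (at x within S)"
proof -
  have "(v *\<^sub>R f', v *\<^sub>R g') = v *\<^sub>R (f', g')" for v by simp
  then show ?thesis
    using has_derivative_gmul[OF assms[unfolded has_vector_derivative_def]]
    unfolding has_vector_derivative_def by (simp only: blinfun.scaleR_right)
qed

lemma Dm_fst: "Dm (p, 0) (v, 0) = v"
proof -
  have "((\<lambda>x. x \<star> 0) has_derivative (\<lambda>v. Dm (p, 0) (v, 0))) (at p)"
    by (rule has_derivative_gmul) (auto intro!: derivative_eq_intros)
  then have "((\<lambda>x. x) has_derivative (\<lambda>v. Dm (p, 0) (v, 0))) (at p)" by simp
  from has_derivative_unique[OF this has_derivative_ident] show ?thesis by metis
qed

lemma Dm_snd: "Dm (0, p) (0, v) = v"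
proof -
  have "((\<lambda>x. 0 \<star> x) has_derivative (\<lambda>v. Dm (0, p) (0, v))) (at p)"
    by (rule has_derivative_gmul) (auto intro!: derivative_eq_intros)
  then have "((\<lambda>x. x) has_derivative (\<lambda>v. Dm (0, p) (0, v))) (at p)" by simp
  from has_derivative_unique[OF this has_derivative_ident] show ?thesis by metis
qed

lemma Dm_0: "Dm (0, 0) (v, w) = v + w"
  using blinfun.add_right[of "Dm (0,0)" "(v, 0)" "(0, w)"] by (simp add: Dm_fst Dm_snd)

lemma lvf_eq: "lvf (\<star>) X p = Dm (p, 0) (0, X)"
  and lvf_derivative_0: "((\<lambda>s. p \<star> (s *\<^sub>R X)) has_vector_derivative lvf (\<star>) X p) (at 0)"
proof -
  have *: "((\<lambda>s. p \<star> (s *\<^sub>R X)) has_vector_derivative Dm (p, 0 *\<^sub>R X) (0, X)) (at 0)"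
    by (rule has_vector_derivative_gmul) (auto intro!: derivative_eq_intros)
  then show "lvf (\<star>) X p = Dm (p, 0) (0, X)"
    unfolding lvf_def by (simp add: vector_derivative_at)
  with * show "((\<lambda>s. p \<star> (s *\<^sub>R X)) has_vector_derivative lvf (\<star>) X p) (at 0)" by simp
qed

lemma lvf_derivative:
  "((\<lambda>s. p \<star> (s *\<^sub>R X)) has_vector_derivative lvf (\<star>) X (p \<star> (s *\<^sub>R X))) (at s)"
  by (rule has_vector_derivative_translate)
     (use lvf_derivative_0[of "p \<star> (s *\<^sub>R X)" X] in \<open>simp add: assoc one_param\<close>)

lemma lvf_linear: "linear (\<lambda>X. lvf (\<star>) X p)"
proof -
  have "(0, x + y) = (0::'g, x) + (0, y)" for x y :: 'g by simp
  moreover have "(0, r *\<^sub>R x) = r *\<^sub>R (0::'g, x)" for r and x :: 'g by simp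
  ultimately show ?thesis
    by (intro linearI) (simp_all only: lvf_eq blinfun.add_right blinfun.scaleR_right)
qed

lemma one_param_subgroup_eq:
  assumes hom: "\<And>s t::real. \<gamma> (s + t) = \<gamma> s \<star> \<gamma> t"
    and der: "(\<gamma> has_vector_derivative Y) (at 0)"
  shows "\<gamma> s = s *\<^sub>R Y"
proof -
  have \<gamma>0: "\<gamma> 0 = 0"
    using hom[of 0 0] gmul_cancel_left[of "\<gamma> 0" "\<gamma> 0" 0] by simp
  define \<delta> where "\<delta> s = (- s *\<^sub>R Y) \<star> \<gamma> s" for s
  have "(\<delta> has_vector_derivative 0) (at s)" for s
  proof (rule has_vector_derivative_translate)
    have "((\<lambda>\<epsilon>. (- \<epsilon> *\<^sub>R Y) \<star> \<gamma> \<epsilon>) has_vector_derivative Dm (- 0 *\<^sub>R Y, \<gamma> 0) (- Y, Y)) (at 0)"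
      by (rule has_vector_derivative_gmul) (auto intro!: derivative_eq_intros der)
    then have 1: "((\<lambda>\<epsilon>. (- \<epsilon> *\<^sub>R Y) \<star> \<gamma> \<epsilon>) has_vector_derivative 0) (at 0)"
      by (simp add: \<gamma>0 Dm_0)
    have "((\<lambda>\<epsilon>. (- s *\<^sub>R Y) \<star> ((- \<epsilon> *\<^sub>R Y) \<star> \<gamma> \<epsilon>) \<star> \<gamma> s) has_vector_derivative
       Dm ((- s *\<^sub>R Y) \<star> ((- 0 *\<^sub>R Y) \<star> \<gamma> 0), \<gamma> s) (Dm (- s *\<^sub>R Y, (- 0 *\<^sub>R Y) \<star> \<gamma> 0) (0, 0), 0)) (at 0)"
      by (intro has_vector_derivative_gmul 1) auto
    moreover have "\<delta> (s + \<epsilon>) = (- s *\<^sub>R Y) \<star> ((- \<epsilon> *\<^sub>R Y) \<star> \<gamma> \<epsilon>) \<star> \<gamma> s" for \<epsilon>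
      using one_param[of "-s" Y "-\<epsilon>"] hom[of \<epsilon> s] by (simp add: \<delta>_def assoc[symmetric] add.commute)
    moreover have "blinfun_apply L (0, 0) = 0" for L :: "('g \<times> 'g) \<Rightarrow>\<^sub>L 'g"
      using blinfun.zero_right[of L] by (simp add: zero_prod_def)
    ultimately show "((\<lambda>\<epsilon>. \<delta> (s + \<epsilon>)) has_vector_derivative 0) (at 0)"
      by simp
  qed
  then obtain c where "\<And>s. \<delta> s = c"
    using has_vector_derivative_zero_constant[of UNIV \<delta>] by auto
  then have "\<delta> s = \<delta> 0" by simp
  then have "(- (s *\<^sub>R Y)) \<star> \<gamma> s = 0" by (simp add: \<delta>_def \<gamma>0)
  then show ?thesis by (metis gmul_0(2) gmul_inv_assoc(1))
qed

definition Ad :: "'g \<Rightarrow> 'g \<Rightarrow> 'g" where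
  "Ad x y = x \<star> y \<star> (- x)"

lemma Ad_0 [simp]: "Ad 0 y = y" "Ad x 0 = 0"
  by (simp_all add: Ad_def)

lemma Ad_hom: "Ad x (y \<star> z) = Ad x y \<star> Ad x z"
  by (simp add: Ad_def assoc)

lemma inv_gmul: "- (x \<star> y) = (- y) \<star> (- x)"
proof -
  have "(x \<star> y) \<star> ((- y) \<star> (- x)) = (x \<star> y) \<star> (- (x \<star> y))"
    by (simp add: assoc)
  then show ?thesis unfolding gmul_cancel_left by simp
qed

lemma Ad_Ad: "Ad (x \<star> y) z = Ad x (Ad y z)"
  by (simp add: Ad_def inv_gmul assoc)

lemma Ad_inv [simp]: "Ad x (Ad (- x) y) = y" "Ad (- x) (Ad x y) = y"
  by (simp_all flip: Ad_Ad)

lemma linear_Ad: "linear (Ad x)"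
proof -
  have d: "((\<lambda>y. Ad x y) has_derivative
       (\<lambda>v. Dm (x \<star> 0, - x) (Dm (x, 0) (0, v), 0))) (at 0)"
    unfolding Ad_def by (intro has_derivative_gmul) auto
  then interpret E: bounded_linear "(\<lambda>v. Dm (x \<star> 0, - x) (Dm (x, 0) (0, v), 0))"
    by (rule has_derivative_bounded_linear)
  have "Ad x Y = Dm (x \<star> 0, - x) (Dm (x, 0) (0, Y), 0)" for Y
  proof -
    have "((\<lambda>s. Ad x (s *\<^sub>R Y)) has_derivative (\<lambda>v. Dm (x \<star> 0, - x) (Dm (x, 0) (0, v *\<^sub>R Y), 0))) (at 0)"
      by (rule has_derivative_compose[of "\<lambda>s. s *\<^sub>R Y" "\<lambda>s. s *\<^sub>R Y" 0 UNIV "Ad x"])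
         (use d in \<open>auto intro!: derivative_eq_intros\<close>)
    then have "((\<lambda>s. Ad x (s *\<^sub>R Y)) has_vector_derivative Dm (x \<star> 0, - x) (Dm (x, 0) (0, Y), 0)) (at 0)"
      unfolding has_vector_derivative_def by (simp only: E.scaleR)
    from one_param_subgroup_eq[OF _ this, of 1] show ?thesis
      by (simp add: Ad_hom flip: one_param)
  qed
  then have "Ad x = (\<lambda>v. Dm (x \<star> 0, - x) (Dm (x, 0) (0, v), 0))" by auto
  then show ?thesis using E.linear_axioms by simp
qed

lemma Ad_diff0: "\<exists>E. \<forall>Y. ((\<lambda>x. Ad x Y) has_derivative E Y) (at 0)"
proof -
  have "((\<lambda>x. Ad x Y) has_derivative
       (\<lambda>v. Dm (0 \<star> Y, - 0) (Dm (0, Y) (v, 0), - v))) (at 0)" for Y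
    unfolding Ad_def by (intro has_derivative_gmul) (auto intro!: derivative_eq_intros)
  then show ?thesis by (intro exI allI)
qed

lemma gmul_near_0:
  assumes "e > 0"
  obtains d where "d > 0" "\<And>a b. norm a < d \<Longrightarrow> norm b < d \<Longrightarrow> norm (a \<star> (- b) - (a - b)) \<le> e * norm (a - b)"
proof -
  have "isCont Dm 0" using cont_Dm continuous_on_eq_continuous_at by blast
  then obtain d where d: "d > 0" "\<And>z. norm z < d \<Longrightarrow> norm (Dm z - Dm 0) < e"
    using assms unfolding continuous_at_eps_delta dist_norm by fastforce
  have *: "norm (a \<star> (- b) - (a - b)) \<le> e * norm (a - b)" if "norm a < d/2" "norm b < d/2" for a b
  proof -
    define G where "G z = fst z \<star> snd z - fst z - snd z" for z :: "'g \<times> 'g"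
    have "(G has_derivative (\<lambda>v. blinfun_apply (Dm z - Dm 0) v)) (at z)" for z
    proof -
      have "(G has_derivative (\<lambda>v. Dm (fst z, snd z) (fst v, snd v) - fst v - snd v)) (at z)"
        unfolding G_def by (intro has_derivative_diff has_derivative_gmul) (auto intro!: derivative_eq_intros)
      moreover have "Dm 0 v = fst v + snd v" for v
        using Dm_0[of "fst v" "snd v"] by (simp add: zero_prod_def)
      ultimately show ?thesis by (simp add: blinfun.diff_left diff_diff_eq)
    qed
    then have "norm (G (a, -b) - G (b, -b)) \<le> e * norm ((a, -b) - (b, -b))"
    proof (intro differentiable_bound[of "ball 0 d"])
      show "convex (ball (0::'g\<times>'g) d)" by simp
      show "(a, -b) \<in> ball 0 d" "(b, -b) \<in> ball 0 d"
        using that norm_Pair_le[of a "-b"] norm_Pair_le[of b "-b"] by auto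
      show "onorm (\<lambda>v. blinfun_apply (Dm z - Dm 0) v) \<le> e" if "z \<in> ball 0 d" for z
        using d(2)[of z] that by (simp add: norm_blinfun.rep_eq less_imp_le)
    qed (auto intro: has_derivative_at_withinI)
    then show ?thesis by (simp add: G_def norm_Pair algebra_simps)
  qed
  show ?thesis by (rule that[of "d/2"]) (use d * in auto)
qed

lemma br_eq_Ad_derivative: "((\<lambda>s. Ad (s *\<^sub>R X) Y) has_vector_derivative br X Y) (at 0)"
proof -
  obtain E where E: "\<And>Y. ((\<lambda>x. Ad x Y) has_derivative E Y) (at 0)" using Ad_diff0 by blast
  have lin: "linear (E Y)" for Y using E has_derivative_linear by blast
  have "((\<lambda>s. Ad (s *\<^sub>R X) Y) has_derivative (\<lambda>s. E Y (s *\<^sub>R X))) (at 0)"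
    by (rule has_derivative_compose[of "\<lambda>s. s *\<^sub>R X" "\<lambda>s. s *\<^sub>R X" 0 UNIV "\<lambda>x. Ad x Y"])
       (use E in \<open>auto intro!: derivative_eq_intros\<close>)
  then have der: "((\<lambda>s. Ad (s *\<^sub>R X) Y) has_vector_derivative E Y X) (at 0)"
    unfolding has_vector_derivative_def by (simp add: linear_cmul[OF lin])
  define q where "q s = (Ad (s *\<^sub>R X) Y - Y) /\<^sub>R s" for s
  have q: "(q \<longlongrightarrow> E Y X) (at 0)"
    using der unfolding has_vector_derivative_at_0_iff q_def by simp
  have cA: "((\<lambda>s. s *\<^sub>R Ad (s *\<^sub>R X) Y) \<longlongrightarrow> 0 *\<^sub>R Ad (0 *\<^sub>R X) Y) (at 0)"
    by (intro tendsto_intros) (use has_vector_derivative_continuous[OF der] in \<open>simp add: continuous_within\<close>)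
  have cY: "((\<lambda>s. s *\<^sub>R Y) \<longlongrightarrow> 0 *\<^sub>R Y) (at 0)" by (intro tendsto_intros)
  define k where "k s = (1 / s\<^sup>2) *\<^sub>R ((s *\<^sub>R X) \<star> (s *\<^sub>R Y) \<star> (- (s *\<^sub>R X)) \<star> (- (s *\<^sub>R Y)))" for s :: real
  have "((\<lambda>s. k s - q s) \<longlongrightarrow> 0) (at 0)"
  proof (rule tendstoI)
    fix e :: real assume "e > 0"
    define C where "C = norm (E Y X) + 1"
    have "C > 0" by (simp add: C_def add_nonneg_pos)
    obtain d where d: "d > 0" "\<And>a b. norm a < d \<Longrightarrow> norm b < d \<Longrightarrow>
        norm (a \<star> (- b) - (a - b)) \<le> (e / (2 * C)) * norm (a - b)"
      using gmul_near_0[of "e / (2 * C)"] \<open>e > 0\<close> \<open>C > 0\<close> by auto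
    have "\<forall>\<^sub>F s in at 0. norm (q s) < C"
      using order_tendstoD(2)[OF tendsto_norm[OF q], of C] by (simp add: C_def)
    moreover have "\<forall>\<^sub>F s in at 0. norm (s *\<^sub>R Ad (s *\<^sub>R X) Y) < d"
      using tendstoD[OF cA, of d] d(1) by simp
    moreover have "\<forall>\<^sub>F s in at 0. norm (s *\<^sub>R Y) < d"
      using tendstoD[OF cY, of d] d(1) by simp
    moreover have "\<forall>\<^sub>F s in at (0::real). s \<noteq> 0" by (simp add: eventually_at_filter)
    ultimately show "\<forall>\<^sub>F s in at 0. dist (k s - q s) 0 < e"
    proof eventually_elim
      case (elim s)
      define a where "a = s *\<^sub>R Ad (s *\<^sub>R X) Y"
      define b where "b = s *\<^sub>R Y"
      have k: "k s = (1 / s\<^sup>2) *\<^sub>R (a \<star> (- b))"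
        using linear_cmul[OF linear_Ad[of "s *\<^sub>R X"], of s Y] by (simp add: k_def a_def b_def Ad_def)
      have q': "q s = (1 / s\<^sup>2) *\<^sub>R (a - b)"
        using elim by (simp add: q_def a_def b_def power2_eq_square scaleR_diff_right inverse_eq_divide)
      have ab: "norm (a - b) = s\<^sup>2 * norm (q s)"
        unfolding q' using elim by simp
      have "norm (k s - q s) = (1 / s\<^sup>2) * norm (a \<star> (- b) - (a - b))"
        unfolding k q' scaleR_diff_right[symmetric] by simp
      also have "\<dots> \<le> (1 / s\<^sup>2) * ((e / (2 * C)) * norm (a - b))"
        using elim d(2)[of a b] by (intro mult_left_mono) (auto simp: a_def b_def)
      also have "\<dots> = (e / (2 * C)) * norm (q s)"
        unfolding ab using elim by simp
      also have "\<dots> \<le> (e / (2 * C)) * C"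
        using elim \<open>e > 0\<close> \<open>C > 0\<close> by (intro mult_left_mono) auto
      also have "\<dots> < e" using \<open>e > 0\<close> \<open>C > 0\<close> by simp
      finally show ?case by simp
    qed
  qed
  from tendsto_add[OF this q] have "(k \<longlongrightarrow> E Y X) (at 0)" by simp
  moreover have "(k \<longlongrightarrow> br X Y) (at 0)" using commutator_lim unfolding k_def .
  ultimately have "br X Y = E Y X" by (intro tendsto_unique[of "at (0::real)"]) auto
  with der show ?thesis by simp
qed

lemma bilinear_br: "bilinear br"
proof -
  obtain E where E: "\<And>Y. ((\<lambda>x. Ad x Y) has_derivative E Y) (at 0)" using Ad_diff0 by blast
  have lin: "linear (E Y)" for Y using E has_derivative_linear by blast
  have br: "br X Y = E Y X" for X Y
  proof -
    have "((\<lambda>s. Ad (s *\<^sub>R X) Y) has_derivative (\<lambda>s. E Y (s *\<^sub>R X))) (at 0)"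
      by (rule has_derivative_compose[of "\<lambda>s. s *\<^sub>R X" "\<lambda>s. s *\<^sub>R X" 0 UNIV "\<lambda>x. Ad x Y"])
         (use E in \<open>auto intro!: derivative_eq_intros\<close>)
    then have der: "((\<lambda>s. Ad (s *\<^sub>R X) Y) has_vector_derivative E Y X) (at 0)"
      unfolding has_vector_derivative_def by (simp add: linear_cmul[OF lin])
    show ?thesis by (rule vector_derivative_unique_at[OF br_eq_Ad_derivative der])
  qed
  have "linear (br X)" for X
  proof (rule linearI)
    show "br X (y + z) = br X y + br X z" for y z
      using has_vector_derivative_add[OF br_eq_Ad_derivative[of X y] br_eq_Ad_derivative[of X z]]
      by (intro vector_derivative_unique_at[OF br_eq_Ad_derivative]) (simp add: linear_add[OF linear_Ad])
    show "br X (r *\<^sub>R y) = r *\<^sub>R br X y" for r y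
      using has_vector_derivative_scaleR[OF DERIV_const[of r] br_eq_Ad_derivative[of X y]]
      by (intro vector_derivative_unique_at[OF br_eq_Ad_derivative]) (simp add: linear_cmul[OF linear_Ad])
  qed
  moreover have "linear (\<lambda>X. br X Y)" for Y using lin by (simp add: br)
  ultimately show ?thesis by (simp add: bilinear_def)
qed

lemma br_self: "br X X = 0"
proof -
  have "Ad (s *\<^sub>R X) X = X" for s
    using one_param[of s X 1] one_param[of "s + 1" X "- s"] by (simp add: Ad_def)
  then have "((\<lambda>s. Ad (s *\<^sub>R X) X) has_vector_derivative 0) (at (0::real))" by simp
  then show ?thesis by (rule vector_derivative_unique_at[OF br_eq_Ad_derivative])
qed

lemma br_skew: "br X Y = - br Y X"
proof -
  have "br (X + Y) (X + Y) = br X Y + br Y X"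
    by (simp only: bilinear_ladd[OF bilinear_br] bilinear_radd[OF bilinear_br]) (simp add: br_self)
  then show ?thesis by (simp add: br_self eq_neg_iff_add_eq_0)
qed

lemma Ad_derivative: "((\<lambda>s. Ad (s *\<^sub>R X) Y) has_vector_derivative Ad (s *\<^sub>R X) (br X Y)) (at s)"
proof (rule has_vector_derivative_translate)
  have "Ad ((s + \<epsilon>) *\<^sub>R X) Y = Ad (s *\<^sub>R X) (Ad (\<epsilon> *\<^sub>R X) Y)" for \<epsilon>
    by (simp flip: Ad_Ad add: one_param)
  then show "((\<lambda>\<epsilon>. Ad ((s + \<epsilon>) *\<^sub>R X) Y) has_vector_derivative Ad (s *\<^sub>R X) (br X Y)) (at 0)"
    using bounded_linear.has_vector_derivative[OF linear_conv_bounded_linear[THEN iffD1, OF linear_Ad] br_eq_Ad_derivative]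
    by simp
qed

text \<open>The Maurer--Cartan form: \<open>T p\<close> inverts \<open>X \<mapsto> lvf (\<star>) X p\<close>.\<close>

definition T :: "'g \<Rightarrow> 'g \<Rightarrow> 'g" where
  "T p v = Dm (- p, p) (0, v)"

lemma T_derivative:
  assumes "(f has_vector_derivative v) (at x)"
  shows "((\<lambda>s. (- f x) \<star> f s) has_vector_derivative T (f x) v) (at x)"
  unfolding T_def by (intro has_vector_derivative_gmul assms) auto

lemma linear_T: "linear (T p)"
proof -
  have "(0, x + y) = (0::'g, x) + (0, y)" for x y :: 'g by simp
  moreover have "(0, r *\<^sub>R x) = r *\<^sub>R (0::'g, x)" for r and x :: 'g by simp
  ultimately show ?thesis
    unfolding T_def by (intro linearI) (simp_all only: blinfun.add_right blinfun.scaleR_right)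
qed

lemma lvf_T [simp]: "lvf (\<star>) (T p v) p = v"
proof -
  have l: "((\<lambda>s. p + s *\<^sub>R v) has_vector_derivative v) (at 0)"
    by (auto intro!: derivative_eq_intros)
  have "((\<lambda>s. p \<star> ((- p) \<star> (p + s *\<^sub>R v))) has_vector_derivative
      Dm (p, (- p) \<star> (p + 0 *\<^sub>R v)) (0, T p v)) (at 0)"
    by (intro has_vector_derivative_gmul) (use T_derivative[OF l] in auto)
  then have "((\<lambda>s. p + s *\<^sub>R v) has_vector_derivative lvf (\<star>) (T p v) p) (at 0)"
    by (simp add: lvf_eq)
  then show ?thesis by (rule vector_derivative_unique_at[OF _ l])
qed

text \<open>Along a line \<open>T\<close> is a cocycle, which reduces its derivative to the one at \<open>0\<close>; since \<open>gmul\<close> is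
  only assumed C1, second derivatives are not available here.\<close>

lemma T_line_derivative:
  "((\<lambda>\<tau>. T (\<tau> *\<^sub>R p) (\<tau> *\<^sub>R v)) has_vector_derivative Ad (- \<tau> *\<^sub>R p) v) (at \<tau>)"
proof -
  define F where "F \<tau> = T (\<tau> *\<^sub>R p) (\<tau> *\<^sub>R v)" for \<tau>
  define \<kappa> where "\<kappa> \<tau> s = (- \<tau> *\<^sub>R p) \<star> (\<tau> *\<^sub>R (p + s *\<^sub>R v))" for \<tau> s :: real
  have \<kappa>0: "\<kappa> \<tau> 0 = 0" for \<tau> by (simp add: \<kappa>_def)
  have \<kappa>: "(\<kappa> \<tau> has_vector_derivative F \<tau>) (at 0)" for \<tau>
  proof -
    have "((\<lambda>s. \<tau> *\<^sub>R (p + s *\<^sub>R v)) has_vector_derivative \<tau> *\<^sub>R v) (at 0)"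
      by (auto intro!: derivative_eq_intros)
    from T_derivative[OF this] show ?thesis by (simp add: \<kappa>_def[abs_def] F_def)
  qed
  have F_add: "F (\<tau> + \<epsilon>) = F \<tau> + Ad (- \<tau> *\<^sub>R p) (F \<epsilon>)" for \<tau> \<epsilon>
  proof -
    have eq: "\<kappa> (\<tau> + \<epsilon>) s = Ad (- \<tau> *\<^sub>R p) (\<kappa> \<epsilon> s) \<star> \<kappa> \<tau> s" for s
    proof -
      have "- (\<tau> + \<epsilon>) *\<^sub>R p = (- \<tau> *\<^sub>R p) \<star> (- \<epsilon> *\<^sub>R p)"
        by (subst one_param) simp
      moreover have "(\<tau> + \<epsilon>) *\<^sub>R (p + s *\<^sub>R v) = (\<epsilon> *\<^sub>R (p + s *\<^sub>R v)) \<star> (\<tau> *\<^sub>R (p + s *\<^sub>R v))"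
        by (subst one_param) (simp add: add.commute)
      ultimately show ?thesis by (simp add: \<kappa>_def Ad_def assoc)
    qed
    have "((\<lambda>s. Ad (- \<tau> *\<^sub>R p) (\<kappa> \<epsilon> s) \<star> \<kappa> \<tau> s) has_vector_derivative
        Dm (Ad (- \<tau> *\<^sub>R p) (\<kappa> \<epsilon> 0), \<kappa> \<tau> 0) (Ad (- \<tau> *\<^sub>R p) (F \<epsilon>), F \<tau>)) (at 0)"
      by (intro has_vector_derivative_gmul \<kappa>
          bounded_linear.has_vector_derivative[OF linear_conv_bounded_linear[THEN iffD1, OF linear_Ad]])
    then have "(\<kappa> (\<tau> + \<epsilon>) has_vector_derivative Ad (- \<tau> *\<^sub>R p) (F \<epsilon>) + F \<tau>) (at 0)"
      by (simp add: \<kappa>0 Dm_0 eq[abs_def])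
    from vector_derivative_unique_at[OF \<kappa> this] show ?thesis by (simp add: add.commute)
  qed
  have "(F has_vector_derivative v) (at 0)"
  proof -
    have "((\<lambda>\<epsilon>. Dm (- \<epsilon> *\<^sub>R p, \<epsilon> *\<^sub>R p)) \<longlongrightarrow> Dm (- 0 *\<^sub>R p, 0 *\<^sub>R p)) (at 0)"
      by (rule continuous_on_tendsto_compose[OF cont_Dm]) (auto intro!: tendsto_eq_intros)
    then have "((\<lambda>\<epsilon>. Dm (- \<epsilon> *\<^sub>R p, \<epsilon> *\<^sub>R p) (0, v)) \<longlongrightarrow> Dm (- 0 *\<^sub>R p, 0 *\<^sub>R p) (0, v)) (at 0)"
      by (intro tendsto_intros)
    then have "((\<lambda>\<epsilon>. T (\<epsilon> *\<^sub>R p) v) \<longlongrightarrow> v) (at 0)"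
      by (simp add: T_def Dm_snd)
    moreover have "\<forall>\<^sub>F \<epsilon> in at (0::real). T (\<epsilon> *\<^sub>R p) v = (F (0 + \<epsilon>) - F 0) /\<^sub>R \<epsilon>"
      unfolding eventually_at_filter by (intro always_eventually) (auto simp: F_def linear_cmul[OF linear_T] linear_0[OF linear_T])
    ultimately have "((\<lambda>\<epsilon>. (F (0 + \<epsilon>) - F 0) /\<^sub>R \<epsilon>) \<longlongrightarrow> v) (at 0)"
      by (rule Lim_transform_eventually)
    then show ?thesis by (simp add: has_vector_derivative_at_0_iff)
  qed
  note bounded_linear.has_vector_derivative[OF linear_conv_bounded_linear[THEN iffD1, OF linear_Ad[of "- \<tau> *\<^sub>R p"]] this]
  from has_vector_derivative_add[OF has_vector_derivative_const[of "F \<tau>"] this]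
  have "((\<lambda>\<epsilon>. F (\<tau> + \<epsilon>)) has_vector_derivative Ad (- \<tau> *\<^sub>R p) v) (at 0)"
    unfolding F_add by simp
  then show ?thesis
    unfolding F_def[symmetric] by (rule has_vector_derivative_translate)
qed

end

section \<open>Algebras of functions and locally nilpotent derivations\<close>

inductive_set alg_gen :: "('a \<Rightarrow> complex) set \<Rightarrow> ('a \<Rightarrow> complex) set" for B where
  const: "(\<lambda>_. a) \<in> alg_gen B"
| base: "f \<in> B \<Longrightarrow> f \<in> alg_gen B"
| add: "f \<in> alg_gen B \<Longrightarrow> g \<in> alg_gen B \<Longrightarrow> (\<lambda>x. f x + g x) \<in> alg_gen B"
| mult: "f \<in> alg_gen B \<Longrightarrow> g \<in> alg_gen B \<Longrightarrow> (\<lambda>x. f x * g x) \<in> alg_gen B"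

definition subalg :: "('a \<Rightarrow> complex) set \<Rightarrow> bool" where
  "subalg M \<longleftrightarrow> (\<forall>a. (\<lambda>_. a) \<in> M) \<and> (\<forall>f\<in>M. \<forall>g\<in>M. (\<lambda>x. f x + g x) \<in> M \<and> (\<lambda>x. f x * g x) \<in> M)"

lemma subalg_const: "subalg M \<Longrightarrow> (\<lambda>_. a) \<in> M"
  and subalg_add: "subalg M \<Longrightarrow> f \<in> M \<Longrightarrow> g \<in> M \<Longrightarrow> (\<lambda>x. f x + g x) \<in> M"
  and subalg_mult: "subalg M \<Longrightarrow> f \<in> M \<Longrightarrow> g \<in> M \<Longrightarrow> (\<lambda>x. f x * g x) \<in> M"
  by (auto simp: subalg_def)

lemma subalg_cmult: "subalg M \<Longrightarrow> f \<in> M \<Longrightarrow> (\<lambda>x. a * f x) \<in> M"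
  using subalg_mult[of M "\<lambda>_. a" f] subalg_const[of M a] by simp

lemma subalg_diff: "subalg M \<Longrightarrow> f \<in> M \<Longrightarrow> g \<in> M \<Longrightarrow> (\<lambda>x. f x - g x) \<in> M"
  using subalg_add[of M f "\<lambda>x. (-1) * g x"] subalg_cmult[of M g "-1"] by simp

lemma subalg_power: "subalg M \<Longrightarrow> f \<in> M \<Longrightarrow> (\<lambda>x. f x ^ n) \<in> M"
  by (induction n) (use subalg_const[of M 1] subalg_mult[of M f] in auto)

lemma subalg_sum: "subalg M \<Longrightarrow> (\<And>i. i \<in> I \<Longrightarrow> f i \<in> M) \<Longrightarrow> (\<lambda>x. \<Sum>i\<in>I. f i x) \<in> M"
  by (induction I rule: infinite_finite_induct)
     (use subalg_const[of M 0] in \<open>auto intro: subalg_add\<close>)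

lemma subalg_Int: "subalg M \<Longrightarrow> subalg M' \<Longrightarrow> subalg (M \<inter> M')"
  by (simp add: subalg_def)

lemma subalg_alg_gen: "subalg (alg_gen B)"
  by (auto simp: subalg_def intro: alg_gen.intros)

lemma alg_gen_least: "subalg M \<Longrightarrow> B \<subseteq> M \<Longrightarrow> alg_gen B \<subseteq> M"
proof
  fix f assume "subalg M" "B \<subseteq> M" "f \<in> alg_gen B"
  from this(3) show "f \<in> M"
    by induction (use \<open>subalg M\<close> \<open>B \<subseteq> M\<close> in \<open>auto simp: subalg_def\<close>)
qed

lemma alg_gen_mono: "B \<subseteq> C \<Longrightarrow> alg_gen B \<subseteq> alg_gen C"
  by (rule alg_gen_least[OF subalg_alg_gen]) (auto intro: alg_gen.base)

definition derivation_on :: "('a \<Rightarrow> complex) set \<Rightarrow> (('a \<Rightarrow> complex) \<Rightarrow> 'a \<Rightarrow> complex) \<Rightarrow> bool" where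
  "derivation_on M D \<longleftrightarrow> (\<forall>f\<in>M. D f \<in> M) \<and> (\<forall>a. D (\<lambda>_. a) = (\<lambda>_. 0)) \<and>
     (\<forall>f\<in>M. \<forall>g\<in>M. D (\<lambda>x. f x + g x) = (\<lambda>x. D f x + D g x) \<and>
        D (\<lambda>x. f x * g x) = (\<lambda>x. f x * D g x + D f x * g x))"

lemma derivation_on_closed: "derivation_on M D \<Longrightarrow> f \<in> M \<Longrightarrow> D f \<in> M"
  and derivation_on_const: "derivation_on M D \<Longrightarrow> D (\<lambda>_. a) = (\<lambda>_. 0)"
  and derivation_on_add: "derivation_on M D \<Longrightarrow> f \<in> M \<Longrightarrow> g \<in> M \<Longrightarrow>
         D (\<lambda>x. f x + g x) = (\<lambda>x. D f x + D g x)"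
  and derivation_on_mult: "derivation_on M D \<Longrightarrow> f \<in> M \<Longrightarrow> g \<in> M \<Longrightarrow>
         D (\<lambda>x. f x * g x) = (\<lambda>x. f x * D g x + D f x * g x)"
  by (auto simp: derivation_on_def)

lemma derivation_on_subset:
  "derivation_on M D \<Longrightarrow> M' \<subseteq> M \<Longrightarrow> (\<And>f. f \<in> M' \<Longrightarrow> D f \<in> M') \<Longrightarrow> derivation_on M' D"
  unfolding derivation_on_def by blast

context
  fixes M :: "('a \<Rightarrow> complex) set" and D
  assumes M: "subalg M" and D: "derivation_on M D"
begin

lemma derivation_on_cmult: "f \<in> M \<Longrightarrow> D (\<lambda>x. a * f x) = (\<lambda>x. a * D f x)"
  using derivation_on_mult[OF D subalg_const[OF M, of a], of f] derivation_on_const[OF D, of a]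
  by simp

lemma derivation_on_diff: "f \<in> M \<Longrightarrow> g \<in> M \<Longrightarrow> D (\<lambda>x. f x - g x) = (\<lambda>x. D f x - D g x)"
  using derivation_on_add[OF D, of f "\<lambda>x. (-1) * g x"] derivation_on_cmult[of g "-1"]
    subalg_cmult[OF M, of g "-1"] by simp

lemma derivation_on_sum: "(\<And>i. i \<in> I \<Longrightarrow> f i \<in> M) \<Longrightarrow> D (\<lambda>x. \<Sum>i\<in>I. f i x) = (\<lambda>x. \<Sum>i\<in>I. D (f i) x)"
proof (induction I rule: infinite_finite_induct)
  case (insert i I)
  then show ?case
    using derivation_on_add[OF D, of "f i" "\<lambda>x. \<Sum>i\<in>I. f i x"] subalg_sum[OF M, of I f] by auto
qed (use derivation_on_const[OF D, of 0] in auto)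

lemma derivation_on_power:
  "f \<in> M \<Longrightarrow> D (\<lambda>x. f x ^ Suc n) = (\<lambda>x. of_nat (Suc n) * f x ^ n * D f x)"
proof (induction n)
  case (Suc n)
  have "D (\<lambda>x. f x * f x ^ Suc n) = (\<lambda>x. f x * D (\<lambda>x. f x ^ Suc n) x + D f x * f x ^ Suc n)"
    using derivation_on_mult[OF D Suc.prems subalg_power[OF M Suc.prems]] .
  also have "\<dots> = (\<lambda>x. of_nat (Suc (Suc n)) * f x ^ Suc n * D f x)"
    by (subst Suc.IH[OF Suc.prems]) (simp add: algebra_simps)
  finally show ?case by simp
qed simp

text \<open>The slice theorem for locally nilpotent derivations: \<open>M\<close> is the polynomial ring in the
  slice \<open>s\<close> over the kernel of \<open>D\<close>; the coefficients come from integrating \<open>D f\<close> term by term.\<close>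

context
  fixes s
  assumes s: "s \<in> M" "D s = (\<lambda>_. 1)"
begin

lemma slice_antiderivative:
  fixes k :: "nat \<Rightarrow> 'a \<Rightarrow> complex" and r :: nat
  assumes k: "\<And>l. k l \<in> M" "\<And>l. D (k l) = (\<lambda>_. 0)"
  defines "v \<equiv> \<lambda>x. \<Sum>l<r. k l x * (inverse (of_nat (Suc l)) * s x ^ Suc l)"
  shows "v \<in> M" "D v = (\<lambda>x. \<Sum>l<r. k l x * s x ^ l)"
proof -
  have sM: "(\<lambda>x. inverse (of_nat (Suc l)) * s x ^ Suc l) \<in> M" for l
    by (intro subalg_cmult[OF M] subalg_power[OF M] s)
  have tM: "(\<lambda>x. k l x * (inverse (of_nat (Suc l)) * s x ^ Suc l)) \<in> M" for l
    by (intro subalg_mult[OF M] sM k)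
  show "v \<in> M" unfolding v_def by (intro subalg_sum[OF M] tM)
  have "D (\<lambda>x. k l x * (inverse (of_nat (Suc l)) * s x ^ Suc l)) = (\<lambda>x. k l x * s x ^ l)" for l
  proof -
    have "D (\<lambda>x. k l x * (inverse (of_nat (Suc l)) * s x ^ Suc l)) =
        (\<lambda>x. k l x * D (\<lambda>x. inverse (of_nat (Suc l)) * s x ^ Suc l) x)"
      by (subst derivation_on_mult[OF D k(1) sM]) (simp add: k)
    also have "D (\<lambda>x. inverse (of_nat (Suc l)) * s x ^ Suc l) = (\<lambda>x. s x ^ l)"
      by (subst derivation_on_cmult[OF subalg_power[OF M s(1)]], subst derivation_on_power[OF s(1)])
         (simp add: s mult.assoc[symmetric] del: of_nat_Suc)
    finally show ?thesis .
  qed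
  then show "D v = (\<lambda>x. \<Sum>l<r. k l x * s x ^ l)"
    unfolding v_def by (subst derivation_on_sum[OF tM]) simp
qed

lemma slice_expansion:
  assumes "f \<in> M" "(D ^^ d) f = (\<lambda>_. 0)"
  shows "\<exists>r k. (\<forall>l. k l \<in> M \<and> D (k l) = (\<lambda>_. 0)) \<and> f = (\<lambda>x. \<Sum>l<r. k l x * s x ^ l)"
  using assms
proof (induction d arbitrary: f)
  case 0
  then show ?case
    by (intro exI[of _ 0] exI[of _ "\<lambda>_ _. 0"]) (auto simp: subalg_const[OF M] derivation_on_const[OF D])
next
  case (Suc d)
  have "(D ^^ d) (D f) = (\<lambda>_. 0)"
    using Suc.prems by (simp add: funpow_Suc_right del: funpow.simps)
  with Suc.IH[OF derivation_on_closed[OF D Suc.prems(1)]] obtain r k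
    where k: "\<And>l. k l \<in> M" "\<And>l. D (k l) = (\<lambda>_. 0)" and Df: "D f = (\<lambda>x. \<Sum>l<r. k l x * s x ^ l)"
    by blast
  define v where "v x = (\<Sum>l<r. k l x * (inverse (of_nat (Suc l)) * s x ^ Suc l))" for x
  have v: "v \<in> M" "D v = D f"
    using slice_antiderivative[of k r, OF k] unfolding v_def[abs_def] Df by auto
  define k' where "k' l = (case l of 0 \<Rightarrow> (\<lambda>x. f x - v x) | Suc l \<Rightarrow> (\<lambda>x. inverse (of_nat (Suc l)) * k l x))" for l
  have "k' l \<in> M \<and> D (k' l) = (\<lambda>_. 0)" for l
    using v k derivation_on_diff[OF Suc.prems(1) v(1)] subalg_diff[OF M Suc.prems(1) v(1)]
      subalg_cmult[OF M] derivation_on_cmult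
    by (auto simp: k'_def split: nat.split)
  moreover have "f = (\<lambda>x. \<Sum>l<Suc r. k' l x * s x ^ l)"
    unfolding sum.lessThan_Suc_shift by (simp add: k'_def v_def mult_ac)
  ultimately show ?case by blast
qed

lemma slice_surj:
  assumes "f \<in> M" "(D ^^ d) f = (\<lambda>_. 0)"
  shows "\<exists>v\<in>M. D v = f"
proof -
  obtain r k where k: "\<And>l. k l \<in> M" "\<And>l. D (k l) = (\<lambda>_. 0)" "f = (\<lambda>x. \<Sum>l<r. k l x * s x ^ l)"
    using slice_expansion[OF assms] by blast
  from slice_antiderivative[of k r, OF k(1,2)] k(3) show ?thesis by auto
qed

end
end

fun nilset :: "('i \<Rightarrow> ('a \<Rightarrow> complex) \<Rightarrow> 'a \<Rightarrow> complex) \<Rightarrow> ('a \<Rightarrow> complex) set \<Rightarrow> nat \<Rightarrow> ('a \<Rightarrow> complex) set" where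
  "nilset D M 0 = {\<lambda>_. 0}"
| "nilset D M (Suc d) = {f \<in> M. \<forall>X. D X f \<in> nilset D M d}"

context
  fixes M :: "('a \<Rightarrow> complex) set" and D :: "'i \<Rightarrow> ('a \<Rightarrow> complex) \<Rightarrow> 'a \<Rightarrow> complex"
  assumes M: "subalg M" and D: "\<And>X. derivation_on M (D X)"
begin

lemma nilset_subset: "nilset D M d \<subseteq> M"
  by (cases d) (auto intro: subalg_const[OF M])

lemma nilset_Suc: "nilset D M d \<subseteq> nilset D M (Suc d)"
proof (induction d)
  case 0
  then show ?case using derivation_on_const[OF D] subalg_const[OF M] by auto
qed auto

lemma nilset_mono: "d \<le> d' \<Longrightarrow> nilset D M d \<subseteq> nilset D M d'"
  using nilset_Suc by (rule lift_Suc_mono_le)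

lemma nilset_const: "(\<lambda>_. a) \<in> nilset D M (Suc d)"
proof -
  have "(\<lambda>_. a) \<in> nilset D M (Suc 0)"
    using derivation_on_const[OF D] subalg_const[OF M] by auto
  then show ?thesis using nilset_mono[of "Suc 0" "Suc d"] by auto
qed

lemma nilset_add: "f \<in> nilset D M d \<Longrightarrow> g \<in> nilset D M d \<Longrightarrow> (\<lambda>x. f x + g x) \<in> nilset D M d"
proof (induction d arbitrary: f g)
  case (Suc d)
  then show ?case by (auto simp: subalg_add[OF M] derivation_on_add[OF D])
qed simp

lemma nilset_mult: "f \<in> nilset D M d \<Longrightarrow> g \<in> nilset D M e \<Longrightarrow> (\<lambda>x. f x * g x) \<in> nilset D M (d + e)"
proof (induction "d + e" arbitrary: d e f g)
  case (Suc n)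
  show ?case
  proof (cases "d = 0 \<or> e = 0")
    case True
    then have "(\<lambda>x. f x * g x) = (\<lambda>_. 0)" using Suc.prems by auto
    then show ?thesis using nilset_mono[of 0 "d + e"] by auto
  next
    case False
    then obtain d' e' where de: "d = Suc d'" "e = Suc e'" by (cases d; cases e) auto
    have fM: "f \<in> M" "g \<in> M" using Suc.prems nilset_subset by blast+
    have "D X (\<lambda>x. f x * g x) \<in> nilset D M (d' + e)" for X
      unfolding derivation_on_mult[OF D fM]
    proof (rule nilset_add)
      show "(\<lambda>x. f x * D X g x) \<in> nilset D M (d' + e)"
        using Suc.hyps(1)[of d e' f "D X g"] Suc.hyps(2) Suc.prems de by simp
      show "(\<lambda>x. D X f x * g x) \<in> nilset D M (d' + e)"
        using Suc.hyps(1)[of d' e "D X f" g] Suc.hyps(2) Suc.prems de by simp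
    qed
    then show ?thesis using subalg_mult[OF M fM] by (simp add: de)
  qed
qed simp

lemma nilset_cmult: "f \<in> nilset D M d \<Longrightarrow> (\<lambda>x. a * f x) \<in> nilset D M d"
proof (induction d arbitrary: f)
  case (Suc d)
  then show ?case by (auto simp: subalg_cmult[OF M] derivation_on_cmult[OF M D])
qed simp

lemma nilset_sum: "(\<And>i. i \<in> I \<Longrightarrow> f i \<in> nilset D M d) \<Longrightarrow> (\<lambda>x. \<Sum>i\<in>I. f i x) \<in> nilset D M d"
  by (induction I rule: infinite_finite_induct)
     (use nilset_mono[of 0 d] nilset_add in auto)

lemma subalg_nil: "subalg (\<Union>d. nilset D M d)"
  unfolding subalg_def
proof (intro conjI allI ballI)
  show "(\<lambda>_. a) \<in> (\<Union>d. nilset D M d)" for a using nilset_const by blast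
  fix f g assume "f \<in> (\<Union>d. nilset D M d)" "g \<in> (\<Union>d. nilset D M d)"
  then obtain d e where de: "f \<in> nilset D M d" "g \<in> nilset D M e" by blast
  then show "(\<lambda>x. f x * g x) \<in> (\<Union>d. nilset D M d)" using nilset_mult by blast
  have "f \<in> nilset D M (max d e)" "g \<in> nilset D M (max d e)"
    using de nilset_mono[of d "max d e"] nilset_mono[of e "max d e"] by auto
  then show "(\<lambda>x. f x + g x) \<in> (\<Union>d. nilset D M d)" using nilset_add by blast
qed

lemma nilset_funpow: "f \<in> nilset D M d \<Longrightarrow> (D X ^^ d) f = (\<lambda>_. 0)"
  by (induction d arbitrary: f) (simp_all add: funpow_Suc_right del: funpow.simps)

end

lemma nilset_by_basis:
  fixes D :: "'i::euclidean_space \<Rightarrow> ('a \<Rightarrow> complex) \<Rightarrow> 'a \<Rightarrow> complex"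
  assumes M: "subalg M" and D: "\<And>X. derivation_on M (D X)"
    and lin: "\<And>X f. f \<in> M \<Longrightarrow> D X f = (\<lambda>x. \<Sum>b\<in>Basis. of_real (X \<bullet> b) * D b f x)"
    and f: "f \<in> M" "\<And>X. D X f \<in> (\<Union>d. nilset D M d)"
  shows "f \<in> (\<Union>d. nilset D M d)"
proof -
  have "\<forall>b. \<exists>d. D b f \<in> nilset D M d" using f(2) by blast
  then obtain d where d: "\<And>b. D b f \<in> nilset D M (d b)" by metis
  define m where "m = Max (d ` Basis)"
  have "D b f \<in> nilset D M m" if "b \<in> Basis" for b
    using d[of b] nilset_mono[where D=D, OF M D, of "d b" m] that Max_ge[of "d ` Basis" "d b"] unfolding m_def by auto
  then have "(\<lambda>x. \<Sum>b\<in>Basis. of_real (X \<bullet> b) * D b f x) \<in> nilset D M m" for X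
    by (intro nilset_sum[where D=D, OF M D] nilset_cmult[where D=D, OF M D]) auto
  then have "D X f \<in> nilset D M m" for X
    by (subst lin[OF f(1)])
  then have "f \<in> nilset D M (Suc m)" using f by simp
  then show ?thesis by blast
qed

section \<open>Flags of ideals and triangular vector fields\<close>

context exp_group begin

lemma Ad_series:
  assumes "(br X ^^ d) Y = 0"
  shows "Ad (s *\<^sub>R X) Y = (\<Sum>l<d. (s ^ l / fact l) *\<^sub>R (br X ^^ l) Y)"
  using assms
proof (induction d arbitrary: s Y)
  case 0
  then show ?case by simp
next
  case (Suc d)
  define G where "G s = Ad (s *\<^sub>R X) Y - (\<Sum>l<Suc d. (s ^ l / fact l) *\<^sub>R (br X ^^ l) Y)" for s
  have IH: "Ad (s *\<^sub>R X) (br X Y) = (\<Sum>l<d. (s ^ l / fact l) *\<^sub>R (br X ^^ Suc l) Y)" for s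
    using Suc.IH[of "br X Y" s] Suc.prems by (simp add: funpow_Suc_right del: funpow.simps)
  have "(G has_vector_derivative 0) (at s)" for s
  proof -
    have *: "((\<lambda>s. s ^ Suc l / fact (Suc l)) has_real_derivative s ^ l / fact l) (at s)" for l
      by (rule derivative_eq_intros refl | simp add: field_simps del: of_nat_Suc)+
    have "((\<lambda>s. \<Sum>l<d. (s ^ Suc l / fact (Suc l)) *\<^sub>R (br X ^^ Suc l) Y) has_vector_derivative
        (\<Sum>l<d. (s ^ l / fact l) *\<^sub>R (br X ^^ Suc l) Y)) (at s)"
      using has_vector_derivative_scaleR[OF * has_vector_derivative_const]
      by (intro has_vector_derivative_sum) simp
    from has_vector_derivative_diff[OF Ad_derivative[of X Y s, unfolded IH] has_vector_derivative_add[OF has_vector_derivative_const[of Y] this]]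
    show ?thesis unfolding G_def sum.lessThan_Suc_shift by simp
  qed
  then obtain c where "\<And>s. G s = c"
    using has_vector_derivative_zero_constant[of UNIV G] by auto
  then have "G s = G 0" by simp
  also have "\<dots> = 0" unfolding G_def sum.lessThan_Suc_shift by simp
  finally show ?case by (simp add: G_def)
qed

lemma T_series:
  assumes "(br p ^^ d) v = 0"
  shows "T p v = (\<Sum>l<d. ((- 1) ^ l / fact (Suc l)) *\<^sub>R (br p ^^ l) v)"
proof -
  define G where "G s = T (s *\<^sub>R p) (s *\<^sub>R v) - (\<Sum>l<d. ((- 1) ^ l * s ^ Suc l / fact (Suc l)) *\<^sub>R (br p ^^ l) v)" for s
  have "(G has_vector_derivative 0) (at s)" for s
  proof -
    have *: "((\<lambda>s. (- 1) ^ l * s ^ Suc l / fact (Suc l)) has_real_derivative (- s) ^ l / fact l) (at s)" for l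
      by (rule derivative_eq_intros refl | simp add: field_simps power_minus[of s] del: of_nat_Suc)+
    have "((\<lambda>s. \<Sum>l<d. ((- 1) ^ l * s ^ Suc l / fact (Suc l)) *\<^sub>R (br p ^^ l) v) has_vector_derivative
        (\<Sum>l<d. ((- s) ^ l / fact l) *\<^sub>R (br p ^^ l) v)) (at s)"
      using has_vector_derivative_scaleR[OF * has_vector_derivative_const]
      by (intro has_vector_derivative_sum) simp
    from has_vector_derivative_diff[OF T_line_derivative[of p v s, unfolded Ad_series[OF assms]] this]
    show ?thesis unfolding G_def by simp
  qed
  then obtain c where "\<And>s. G s = c"
    using has_vector_derivative_zero_constant[of UNIV G] by auto
  then have "G 1 = G 0" by simp
  also have "\<dots> = 0" by (simp add: G_def linear_0[OF linear_T])
  finally show ?thesis by (simp add: G_def)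
qed

end

locale flag_group = exp_group gmul br
  for gmul :: "'g::euclidean_space \<Rightarrow> 'g \<Rightarrow> 'g" (infixl "\<star>" 70) and br +
  fixes e :: "nat \<Rightarrow> 'g" and m :: nat
  assumes m: "m = DIM('g)"
    and orth: "\<And>i j. i < m \<Longrightarrow> j < m \<Longrightarrow> e i \<bullet> e j = (if i = j then 1 else 0)"
    and flag: "\<And>i x y. i < m \<Longrightarrow> \<forall>j<i. e j \<bullet> y = 0 \<Longrightarrow> \<forall>j\<le>i. e j \<bullet> br x y = 0"
begin

lemma expand: "x = (\<Sum>j<m. (e j \<bullet> x) *\<^sub>R e j)"
proof -
  have inj: "inj_on e {..<m}"
    using orth by (intro inj_onI) (metis lessThan_iff zero_neq_one)
  have po: "pairwise orthogonal (e ` {..<m})"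
    using orth unfolding pairwise_def orthogonal_def by auto
  moreover have "0 \<notin> e ` {..<m}" using orth by force
  ultimately have "independent (e ` {..<m})" by (rule pairwise_orthogonal_independent)
  then have "span (e ` {..<m}) = UNIV"
    using inj m by (intro dim_eq_full[THEN iffD1]) (simp add: dim_eq_card_independent card_image)
  then have "(\<Sum>b\<in>e ` {..<m}. (b \<bullet> x) *\<^sub>R b) = x"
    using orthonormal_basis_expand[OF po, of x] orth by (force simp: norm_eq_1 inner_commute)
  then show ?thesis by (simp add: sum.reindex[OF inj])
qed

definition F :: "nat \<Rightarrow> 'g set" where
  "F i = {x. \<forall>j<i. e j \<bullet> x = 0}"

lemma F_0 [simp]: "F 0 = UNIV"
  by (simp add: F_def)

lemma F_m: "F m = {0}"
proof -
  have "x = 0" if "x \<in> F m" for x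
    using that by (subst expand[of x]) (auto simp: F_def)
  then show ?thesis by (auto simp: F_def)
qed

lemma F_mono: "i \<le> j \<Longrightarrow> F j \<subseteq> F i"
  by (auto simp: F_def)

lemma F_Suc: "x \<in> F (Suc i) \<longleftrightarrow> x \<in> F i \<and> e i \<bullet> x = 0"
  by (auto simp: F_def less_Suc_eq)

lemma subspace_F: "subspace (F i)"
  by (auto simp: F_def subspace_def inner_right_distrib)

lemma e_in_F: "i \<le> j \<Longrightarrow> j < m \<Longrightarrow> e j \<in> F i"
  using orth by (auto simp: F_def)

lemma F_ge_m: "m \<le> i \<Longrightarrow> F i = {0}"
  using F_mono[of m i] F_m subspace_0[OF subspace_F, of i] by auto

lemma br_F: "y \<in> F i \<Longrightarrow> br x y \<in> F (Suc i)"
proof (cases "i < m")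
  case True
  then show "y \<in> F i \<Longrightarrow> br x y \<in> F (Suc i)" using flag by (auto simp: F_def)
next
  case False
  then show "y \<in> F i \<Longrightarrow> br x y \<in> F (Suc i)"
    using F_ge_m[of i] subspace_0[OF subspace_F] by (simp add: bilinear_rzero[OF bilinear_br])
qed

lemma br_F_left: "x \<in> F i \<Longrightarrow> br x y \<in> F (Suc i)"
  using br_F[of x i y] subspace_neg[OF subspace_F] br_skew[of x y] by metis

lemma br_funpow_F: "y \<in> F i \<Longrightarrow> (br x ^^ l) y \<in> F (i + l)"
  by (induction l) (auto intro: br_F)

lemma br_nilpotent: "(br x ^^ m) y = 0"
  using br_funpow_F[of y 0 m x] F_m by simp

definition xc :: "nat \<Rightarrow> 'g \<Rightarrow> complex" where
  "xc j p = of_real (e j \<bullet> p)"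

definition A :: "nat \<Rightarrow> ('g \<Rightarrow> complex) set" where
  "A i = alg_gen (xc ` {..<i})"

abbreviation "R \<equiv> A m"

lemma subalg_A: "subalg (A i)"
  by (simp add: A_def subalg_alg_gen)

lemmas R_intros = subalg_const[OF subalg_A] subalg_add[OF subalg_A] subalg_mult[OF subalg_A]
  subalg_cmult[OF subalg_A] subalg_diff[OF subalg_A] subalg_sum[OF subalg_A]

lemma xc_A: "j < i \<Longrightarrow> xc j \<in> A i"
  by (auto simp: A_def intro: alg_gen.base)

lemma A_mono: "i \<le> j \<Longrightarrow> A i \<subseteq> A j"
  unfolding A_def by (intro alg_gen_mono) auto

lemma e_br_expand:
  assumes "i < m"
  shows "e i \<bullet> br p v = (\<Sum>a<i. \<Sum>b<i. (e a \<bullet> p) * (e b \<bullet> v) * (e i \<bullet> br (e a) (e b)))"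
proof -
  have z: "e i \<bullet> br (e a) (e b) = 0" if "a < m" "b < m" "\<not> (a < i \<and> b < i)" for a b
    using that br_F[OF e_in_F[of i b], of "e a"] br_F_left[OF e_in_F[of i a], of "e b"]
    by (auto simp: F_Suc)
  have "br p v = (\<Sum>a<m. \<Sum>b<m. br ((e a \<bullet> p) *\<^sub>R e a) ((e b \<bullet> v) *\<^sub>R e b))"
    by (subst (1) expand[of p], subst (1) expand[of v]) (simp add: bilinear_sum[OF bilinear_br] sum.cartesian_product)
  then have "e i \<bullet> br p v = (\<Sum>a<m. \<Sum>b<m. (e a \<bullet> p) * (e b \<bullet> v) * (e i \<bullet> br (e a) (e b)))"
    by (simp add: inner_sum_right bilinear_lmul[OF bilinear_br] bilinear_rmul[OF bilinear_br] mult_ac)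
  also have "\<dots> = (\<Sum>a<m. \<Sum>b<i. (e a \<bullet> p) * (e b \<bullet> v) * (e i \<bullet> br (e a) (e b)))"
    using assms z by (intro sum.cong refl sum.mono_neutral_right) auto
  also have "\<dots> = (\<Sum>a<i. \<Sum>b<i. (e a \<bullet> p) * (e b \<bullet> v) * (e i \<bullet> br (e a) (e b)))"
    using assms z by (intro sum.mono_neutral_right) (auto intro!: sum.neutral)
  finally show ?thesis .
qed

definition triangular :: "('g \<Rightarrow> 'g) \<Rightarrow> bool" where
  "triangular V \<longleftrightarrow> (\<forall>i<m. (\<lambda>p. of_real (e i \<bullet> V p)) \<in> A i)"

lemma triangular_const: "triangular (\<lambda>_. v)"
  by (simp add: triangular_def R_intros)

lemma triangular_sum: "(\<And>i. i \<in> I \<Longrightarrow> triangular (V i)) \<Longrightarrow> triangular (\<lambda>p. \<Sum>i\<in>I. V i p)"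
  by (auto simp: triangular_def inner_sum_right intro!: R_intros)

lemma triangular_diff: "triangular V \<Longrightarrow> triangular W \<Longrightarrow> triangular (\<lambda>p. V p - W p)"
  by (auto simp: triangular_def inner_diff_right intro!: R_intros)

lemma triangular_scaleR: "triangular V \<Longrightarrow> triangular (\<lambda>p. c *\<^sub>R V p)"
  by (auto simp: triangular_def intro!: R_intros)

lemma triangular_br:
  assumes "triangular V"
  shows "triangular (\<lambda>p. br p (V p))"
  unfolding triangular_def
proof (intro allI impI)
  fix i assume i: "i < m"
  have "(\<lambda>p. complex_of_real (e b \<bullet> V p)) \<in> A i" if "b < i" for b
    using assms that i A_mono[of b i] by (auto simp: triangular_def)
  then have "(\<lambda>p. \<Sum>a<i. \<Sum>b<i. of_real (e i \<bullet> br (e a) (e b)) * (xc a p * of_real (e b \<bullet> V p))) \<in> A i"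
    by (intro R_intros xc_A) auto
  moreover have "complex_of_real (e i \<bullet> br p (V p)) =
      (\<Sum>a<i. \<Sum>b<i. of_real (e i \<bullet> br (e a) (e b)) * (xc a p * of_real (e b \<bullet> V p)))" for p
    by (subst e_br_expand[OF i]) (simp add: xc_def mult_ac)
  ultimately show "(\<lambda>p. complex_of_real (e i \<bullet> br p (V p))) \<in> A i"
    by simp
qed

lemma triangular_br_funpow: "triangular V \<Longrightarrow> triangular (\<lambda>p. (br p ^^ l) (V p))"
  by (induction l) (auto intro: triangular_br)

definition Mp :: "'g \<Rightarrow> 'g \<Rightarrow> 'g" where
  "Mp p v = v - T p v"

lemma T_eq: "T p v = (\<Sum>l<m. ((- 1) ^ l / fact (Suc l)) *\<^sub>R (br p ^^ l) v)"
  by (rule T_series[OF br_nilpotent])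

lemma triangular_Mp: "triangular V \<Longrightarrow> triangular (\<lambda>p. Mp p (V p))"
  unfolding Mp_def T_eq
  by (intro triangular_diff triangular_sum triangular_scaleR triangular_br_funpow)

lemma triangular_Mp_funpow: "triangular V \<Longrightarrow> triangular (\<lambda>p. (Mp p ^^ l) (V p))"
  by (induction l) (auto intro: triangular_Mp)

lemma Mp_F: "v \<in> F i \<Longrightarrow> Mp p v \<in> F (Suc i)"
proof -
  assume v: "v \<in> F i"
  obtain k where k: "m = Suc k" using m by (metis DIM_positive gr0_implies_Suc)
  have "Mp p v = - (\<Sum>l<k. ((- 1) ^ Suc l / fact (Suc (Suc l))) *\<^sub>R (br p ^^ Suc l) v)"
    unfolding Mp_def T_eq unfolding k sum.lessThan_Suc_shift by simp
  moreover have "(br p ^^ Suc l) v \<in> F (Suc i)" for l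
    using br_funpow_F[OF v, of "Suc l" p] F_mono[of "Suc i" "i + Suc l"] by auto
  ultimately show ?thesis
    by (simp only:) (intro subspace_neg subspace_sum subspace_scale subspace_F)
qed

lemma Mp_funpow_F: "v \<in> F i \<Longrightarrow> (Mp p ^^ l) v \<in> F (i + l)"
  by (induction l) (auto intro: Mp_F)

lemma T_F: "v \<in> F i \<Longrightarrow> T p v \<in> F i"
  using Mp_F[of v i p] F_mono[of i "Suc i"] subspace_diff[OF subspace_F, of v i "Mp p v"]
  by (auto simp: Mp_def)

lemma lvf_Mp: "lvf (\<star>) X p = (\<Sum>l<m. (Mp p ^^ l) X)"
proof -
  have "T p (\<Sum>l<m. (Mp p ^^ l) X) = (\<Sum>l<m. (Mp p ^^ l) X - (Mp p ^^ Suc l) X)"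
    by (simp add: linear_sum[OF linear_T] Mp_def)
  also have "\<dots> = X - (Mp p ^^ m) X"
    using sum_lessThan_telescope'[of "\<lambda>l. (Mp p ^^ l) X" m] by simp
  also have "\<dots> = X" using Mp_funpow_F[of X 0 m p] F_m by simp
  finally show ?thesis by (metis lvf_T)
qed

lemma triangular_lvf: "triangular V \<Longrightarrow> triangular (\<lambda>p. lvf (\<star>) (V p) p)"
  unfolding lvf_Mp by (intro triangular_sum triangular_Mp_funpow)

lemma lvf_diff_F: "w \<in> F i \<Longrightarrow> lvf (\<star>) w p - w \<in> F (Suc i)"
proof -
  assume w: "w \<in> F i"
  obtain k where k: "m = Suc k" using m by (metis DIM_positive gr0_implies_Suc)
  have "lvf (\<star>) w p - w = (\<Sum>l<k. (Mp p ^^ Suc l) w)"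
    unfolding lvf_Mp k sum.lessThan_Suc_shift by simp
  moreover have "(Mp p ^^ Suc l) w \<in> F (Suc i)" for l
    using Mp_funpow_F[OF w, of "Suc l" p] F_mono[of "Suc i" "i + Suc l"] by auto
  ultimately show ?thesis
    by (simp only:) (intro subspace_sum subspace_F)
qed

lemma e_lvf: "w \<in> F i \<Longrightarrow> e i \<bullet> lvf (\<star>) w p = e i \<bullet> w"
  using lvf_diff_F[of w i p] by (simp add: F_Suc inner_diff_right)

lemma triangular_rvf: "triangular (\<lambda>p. lvf (\<star>) (Ad (- p) X) p)"
proof -
  have "Ad (- p) X = (\<Sum>l<m. ((- 1) ^ l / fact l) *\<^sub>R (br p ^^ l) X)" for p
    using Ad_series[OF br_nilpotent, of "-1" p X] by simp
  then have "triangular (\<lambda>p. Ad (- p) X)"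
    by (simp only:) (intro triangular_sum triangular_scaleR triangular_br_funpow triangular_const)
  then show ?thesis by (rule triangular_lvf)
qed

end

section \<open>Invariant derivations of the polynomial algebra\<close>

context flag_group begin

definition Dv :: "('g \<Rightarrow> 'g) \<Rightarrow> ('g \<Rightarrow> complex) \<Rightarrow> 'g \<Rightarrow> complex" where
  "Dv V f p = frechet_derivative f (at p) (V p)"

lemma A_differentiable: "f \<in> A i \<Longrightarrow> f differentiable (at p)"
  unfolding A_def
proof (induction rule: alg_gen.induct)
  case (base f)
  then show ?case
    by (auto simp: xc_def[abs_def] intro!: bounded_linear_imp_differentiable
        bounded_linear_compose[OF bounded_linear_of_real] bounded_linear_inner_right)
qed auto

lemma A_has_derivative: "f \<in> A i \<Longrightarrow> (f has_derivative frechet_derivative f (at p)) (at p)"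
  using A_differentiable frechet_derivative_works by blast

lemma linear_frechet_A: "f \<in> A i \<Longrightarrow> linear (frechet_derivative f (at p))"
  using A_has_derivative has_derivative_linear by blast

lemma DvI: "(\<And>p. (f has_derivative f' p) (at p)) \<Longrightarrow> Dv V f = (\<lambda>p. f' p (V p))"
  unfolding Dv_def by (rule ext) (metis frechet_derivative_at)

lemma Dv_const: "Dv V (\<lambda>_. a) = (\<lambda>_. 0)"
  by (rule DvI) simp

lemma Dv_add: "f \<in> A i \<Longrightarrow> g \<in> A i \<Longrightarrow> Dv V (\<lambda>p. f p + g p) = (\<lambda>p. Dv V f p + Dv V g p)"
  unfolding Dv_def[of V f] Dv_def[of V g]
  by (rule DvI) (intro has_derivative_add A_has_derivative)

lemma Dv_mult: "f \<in> A i \<Longrightarrow> g \<in> A i \<Longrightarrow> Dv V (\<lambda>p. f p * g p) = (\<lambda>p. f p * Dv V g p + Dv V f p * g p)"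
  unfolding Dv_def[of V f] Dv_def[of V g]
  by (rule DvI) (intro has_derivative_mult A_has_derivative)

lemma Dv_xc: "Dv V (xc j) = (\<lambda>p. of_real (e j \<bullet> V p))"
  by (rule DvI) (auto simp: xc_def[abs_def] intro!: derivative_eq_intros)

lemma Dv_closed: "triangular V \<Longrightarrow> i \<le> m \<Longrightarrow> f \<in> A i \<Longrightarrow> Dv V f \<in> A i"
proof -
  assume V: "triangular V" and i: "i \<le> m" and "f \<in> A i"
  have "f \<in> alg_gen (xc ` {..<i})" using \<open>f \<in> A i\<close> by (simp add: A_def)
  then show ?thesis
  proof (induction rule: alg_gen.induct)
    case (base f)
    then obtain j where j: "j < i" "f = xc j" by auto
    then show ?case using V i A_mono[of j i] by (auto simp: Dv_xc triangular_def)
  next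
    case (add f g)
    then show ?case using Dv_add[of f i g V] by (auto simp: A_def[symmetric] intro: R_intros)
  next
    case (mult f g)
    then show ?case using Dv_mult[of f i g V] by (auto simp: A_def[symmetric] intro!: R_intros)
  qed (simp add: Dv_const R_intros)
qed

lemma derivation_Dv: "triangular V \<Longrightarrow> derivation_on R (Dv V)"
  unfolding derivation_on_def using Dv_const Dv_add Dv_mult Dv_closed by auto

lemma Dv_linear:
  assumes "\<And>p. linear (\<lambda>X::'g. V X p)" "f \<in> A i"
  shows "linear (\<lambda>X. Dv (V X) f p)"
  using linear_compose[OF assms(1)[of p] linear_frechet_A[OF assms(2), of p]]
  by (simp add: Dv_def o_def)

lemma linear_basis_expand:
  fixes L :: "'g \<Rightarrow> complex"
  assumes "linear L"
  shows "L X = (\<Sum>b\<in>Basis. of_real (X \<bullet> b) * L b)"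
  by (subst (1) euclidean_representation[of X, symmetric])
     (simp add: linear_sum[OF assms] linear_cmul[OF assms] scaleR_conv_of_real)

lemma R_locally_nilpotent:
  fixes V :: "'g \<Rightarrow> 'g \<Rightarrow> 'g"
  assumes tri: "\<And>X. triangular (V X)" and lin: "\<And>p. linear (\<lambda>X. V X p)"
  shows "R \<subseteq> (\<Union>d. nilset (\<lambda>X. Dv (V X)) R d)" (is "_ \<subseteq> ?U")
proof -
  have D: "derivation_on R (Dv (V X))" for X by (rule derivation_Dv[OF tri])
  have U: "subalg ?U" by (rule subalg_nil[OF subalg_A D])
  have "xc j \<in> ?U" if "j < m" for j
    using that
  proof (induction j rule: less_induct)
    case (less j)
    have "A j \<subseteq> ?U"
      unfolding A_def[of j] using less by (intro alg_gen_least[OF U]) auto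
    then have "Dv (V X) (xc j) \<in> ?U" for X
      using tri[of X] less.prems by (auto simp: Dv_xc triangular_def)
    moreover have "Dv (V X) f = (\<lambda>x. \<Sum>b\<in>Basis. of_real (X \<bullet> b) * Dv (V b) f x)" if "f \<in> R" for X f
      by (intro ext linear_basis_expand Dv_linear[OF lin that])
    ultimately show ?case
      using nilset_by_basis[where D="\<lambda>X. Dv (V X)", OF subalg_A D _ xc_A[OF less.prems]] by blast
  qed
  then have "alg_gen (xc ` {..<m}) \<subseteq> ?U"
    by (intro alg_gen_least[OF U]) auto
  then show ?thesis by (simp only: A_def[of m])
qed

definition hat :: "'g \<Rightarrow> ('g \<Rightarrow> complex) \<Rightarrow> 'g \<Rightarrow> complex" where
  "hat X = Dv (lvf (\<star>) X)"

text \<open>The derivation along the right-invariant field: \<open>(sX) \<star> p = p \<star> (s Ad(-p) X)\<close>.\<close>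

definition rhat :: "'g \<Rightarrow> ('g \<Rightarrow> complex) \<Rightarrow> 'g \<Rightarrow> complex" where
  "rhat X = Dv (\<lambda>p. lvf (\<star>) (Ad (- p) X) p)"

lemma rhat_eq: "rhat X f p = hat (Ad (- p) X) f p"
  by (simp add: rhat_def hat_def Dv_def)

lemma derivation_hat: "derivation_on R (hat X)"
  unfolding hat_def using triangular_lvf[OF triangular_const] by (intro derivation_Dv)

lemma derivation_rhat: "derivation_on R (rhat X)"
  unfolding rhat_def by (intro derivation_Dv triangular_rvf)

lemmas hat_R = derivation_on_closed[OF derivation_hat]
  and rhat_R = derivation_on_closed[OF derivation_rhat]

lemma hat_linear: "f \<in> R \<Longrightarrow> linear (\<lambda>X. hat X f p)"
  unfolding hat_def by (rule Dv_linear[OF lvf_linear])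

lemma hat_nil: "R \<subseteq> (\<Union>d. nilset hat R d)"
  using R_locally_nilpotent[of "lvf (\<star>)"] triangular_lvf[OF triangular_const] lvf_linear
  by (simp add: hat_def[abs_def])

lemma rhat_nil: "R \<subseteq> (\<Union>d. nilset rhat R d)"
proof -
  have "linear (\<lambda>X. lvf (\<star>) (Ad (- p) X) p)" for p
    using linear_compose[OF linear_Ad lvf_linear] by (simp add: o_def)
  then show ?thesis
    using R_locally_nilpotent[of "\<lambda>X p. lvf (\<star>) (Ad (- p) X) p"] triangular_rvf
    by (simp add: rhat_def[abs_def])
qed

lemma hat_funpow_zero: "f \<in> R \<Longrightarrow> \<exists>d. f \<in> nilset hat R d \<and> (hat X ^^ d) f = (\<lambda>_. 0)"
  using hat_nil nilset_funpow[where D=hat, OF subalg_A derivation_hat] by blast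

lemma cnj_A: "f \<in> A i \<Longrightarrow> (\<lambda>p. cnj (f p)) \<in> A i"
  unfolding A_def
proof (induction rule: alg_gen.induct)
  case (base f)
  then have "(\<lambda>p. cnj (f p)) = f" by (auto simp: xc_def[abs_def])
  then show ?case using base by (simp add: alg_gen.base)
qed (auto intro: alg_gen.intros)

lemma Dv_cnj: "f \<in> A i \<Longrightarrow> Dv V (\<lambda>p. cnj (f p)) = (\<lambda>p. cnj (Dv V f p))"
  unfolding Dv_def[of V f]
  by (rule DvI) (intro has_derivative_cnj A_has_derivative)

lemma hat_along:
  assumes "f \<in> R"
  shows "((\<lambda>s. f (p \<star> (s *\<^sub>R X))) has_vector_derivative hat X f (p \<star> (s *\<^sub>R X))) (at s)"
  using vector_derivative_diff_chain_within[OF lvf_derivative[of p X s], of f "frechet_derivative f (at (p \<star> (s *\<^sub>R X)))"]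
    A_has_derivative[OF assms, of "p \<star> (s *\<^sub>R X)"]
  by (simp add: hat_def Dv_def o_def has_derivative_at_withinI)

lemma hat_along_0:
  "f \<in> R \<Longrightarrow> ((\<lambda>s. f (p \<star> (s *\<^sub>R X))) has_vector_derivative hat X f p) (at 0)"
  using hat_along[of f p X 0] by simp

lemma hat_funpow_R: "f \<in> R \<Longrightarrow> (hat X ^^ l) f \<in> R"
  by (induction l) (auto intro: hat_R)

lemma hat_taylor:
  assumes "f \<in> R" "(hat X ^^ d) f = (\<lambda>_. 0)"
  shows "f (p \<star> (s *\<^sub>R X)) = (\<Sum>l<d. of_real (s ^ l / fact l) * (hat X ^^ l) f p)"
  using assms
proof (induction d arbitrary: s f)
  case 0
  then show ?case by simp
next
  case (Suc d)
  define G where "G s = f (p \<star> (s *\<^sub>R X)) - (\<Sum>l<Suc d. of_real (s ^ l / fact l) * (hat X ^^ l) f p)" for s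
  have IH: "hat X f (p \<star> (s *\<^sub>R X)) = (\<Sum>l<d. of_real (s ^ l / fact l) * (hat X ^^ Suc l) f p)" for s
    using Suc.IH[of "hat X f" s] Suc.prems hat_R[of f X] by (simp add: funpow_Suc_right del: funpow.simps)
  have "(G has_vector_derivative 0) (at s)" for s
  proof -
    have *: "((\<lambda>s. s ^ Suc l / fact (Suc l)) has_real_derivative s ^ l / fact l) (at s)" for l
      by (rule derivative_eq_intros refl | simp add: field_simps del: of_nat_Suc)+
    have "((\<lambda>s. \<Sum>l<d. of_real (s ^ Suc l / fact (Suc l)) * (hat X ^^ Suc l) f p) has_vector_derivative
        (\<Sum>l<d. of_real (s ^ l / fact l) * (hat X ^^ Suc l) f p)) (at s)"
      by (intro has_vector_derivative_sum has_vector_derivative_mult_left has_vector_derivative_of_real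
          *)
    from has_vector_derivative_diff[OF hat_along[OF Suc.prems(1), of p X s, unfolded IH] has_vector_derivative_add[OF has_vector_derivative_const[of "f p"] this]]
    show ?thesis unfolding G_def sum.lessThan_Suc_shift by simp
  qed
  then obtain c where "\<And>s. G s = c"
    using has_vector_derivative_zero_constant[of UNIV G] by auto
  then have "G s = G 0" by simp
  also have "\<dots> = 0" unfolding G_def sum.lessThan_Suc_shift by simp
  finally show ?case by (simp add: G_def)
qed

text \<open>Compare the Taylor coefficients of \<open>s\<close> in \<open>f (p \<star> sX \<star> tY) = f (p \<star> t Ad(sX)Y \<star> sX)\<close>.\<close>

lemma hat_commutator_at:
  assumes f: "f \<in> R"
  shows "hat X (hat Y f) p = hat Y (hat X f) p + hat (br X Y) f p"
proof -
  obtain d0 where d0: "f \<in> nilset hat R d0" using hat_nil f by blast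
  define d where "d = Suc (Suc d0)"
  have "f \<in> nilset hat R d"
    using d0 nilset_mono[where D=hat, OF subalg_A derivation_hat, of d0 d] by (auto simp: d_def)
  then have d: "(hat X ^^ d) f = (\<lambda>_. 0)" by (rule nilset_funpow[where D=hat, OF subalg_A derivation_hat])
  define B where "B l V = hat V ((hat X ^^ l) f) p" for l V
  have linB: "bounded_linear (B l)" for l
    unfolding B_def using hat_linear[OF hat_funpow_R[OF f]] by (simp add: linear_conv_bounded_linear)
  have eq: "hat Y f (p \<star> (s *\<^sub>R X)) = (\<Sum>l<d. of_real (s ^ l / fact l) * B l (Ad (s *\<^sub>R X) Y))" for s
  proof -
    define V where "V = Ad (s *\<^sub>R X) Y"
    define g where "g q = (\<Sum>l<d. of_real (s ^ l / fact l) * (hat X ^^ l) f q)" for q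
    have tR: "(\<lambda>q. of_real (s ^ l / fact l) * (hat X ^^ l) f q) \<in> R" for l
      by (intro R_intros hat_funpow_R f)
    have gR: "g \<in> R" unfolding g_def[abs_def] by (intro R_intros(6) tR)
    have "f ((p \<star> (s *\<^sub>R X)) \<star> (t *\<^sub>R Y)) = g (p \<star> (t *\<^sub>R V))" for t
    proof -
      have "(p \<star> (s *\<^sub>R X)) \<star> (t *\<^sub>R Y) = (p \<star> (t *\<^sub>R V)) \<star> (s *\<^sub>R X)"
        unfolding V_def linear_cmul[OF linear_Ad, symmetric] by (simp add: Ad_def assoc)
      then show ?thesis by (simp add: hat_taylor[OF f d] g_def)
    qed
    then have "((\<lambda>t. g (p \<star> (t *\<^sub>R V))) has_vector_derivative hat Y f (p \<star> (s *\<^sub>R X))) (at 0)"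
      using hat_along_0[OF f, of "p \<star> (s *\<^sub>R X)" Y] by simp
    from vector_derivative_unique_at[OF this hat_along_0[OF gR]]
    have "hat Y f (p \<star> (s *\<^sub>R X)) = hat V g p" .
    also have "\<dots> = (\<Sum>l<d. hat V (\<lambda>q. of_real (s ^ l / fact l) * (hat X ^^ l) f q) p)"
      unfolding g_def[abs_def] by (subst derivation_on_sum[OF subalg_A derivation_hat tR]) simp
    also have "\<dots> = (\<Sum>l<d. of_real (s ^ l / fact l) * B l V)"
      using derivation_on_cmult[OF subalg_A derivation_hat hat_funpow_R[OF f]] by (simp only: B_def)
    finally show ?thesis by (simp add: V_def)
  qed
  have der: "((\<lambda>s. of_real (s ^ l / fact l) * B l (Ad (s *\<^sub>R X) Y)) has_vector_derivative
      (if l = 0 then B 0 (br X Y) else if l = 1 then B 1 Y else 0)) (at 0)" for l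
  proof -
    have 1: "((\<lambda>s. s ^ l / fact l :: real) has_real_derivative (if l = 1 then 1 else 0)) (at 0)"
      by (cases l) (auto intro!: derivative_eq_intros)
    have 2: "((\<lambda>s. B l (Ad (s *\<^sub>R X) Y)) has_vector_derivative B l (br X Y)) (at 0)"
      by (rule bounded_linear.has_vector_derivative[OF linB br_eq_Ad_derivative])
    from has_vector_derivative_mult[OF has_vector_derivative_of_real[OF 1] 2]
    show ?thesis by (cases "l = 0"; cases "l = 1") (simp_all add: power_0_left)
  qed
  have "((\<lambda>s. hat Y f (p \<star> (s *\<^sub>R X))) has_vector_derivative
      (\<Sum>l<d. if l = 0 then B 0 (br X Y) else if l = 1 then B 1 Y else 0)) (at 0)"
    unfolding eq by (intro has_vector_derivative_sum der)
  moreover have "(\<Sum>l<d. if l = 0 then B 0 (br X Y) else if l = 1 then B 1 Y else 0) = B 0 (br X Y) + B 1 Y"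
    unfolding d_def sum.lessThan_Suc_shift by simp
  ultimately have "((\<lambda>s. hat Y f (p \<star> (s *\<^sub>R X))) has_vector_derivative B 0 (br X Y) + B 1 Y) (at 0)"
    by simp
  from vector_derivative_unique_at[OF hat_along_0[OF hat_R[OF f]] this]
  show ?thesis by (simp add: B_def)
qed

lemma hat_commutator:
  "f \<in> R \<Longrightarrow> hat X (hat Y f) = (\<lambda>p. hat Y (hat X f) p + hat (br X Y) f p)"
  using hat_commutator_at by blast

lemma rhat_hat_commute:
  assumes f: "f \<in> R"
  shows "rhat X (hat Y f) = hat Y (rhat X f)"
proof
  fix p
  define W where "W = Ad (- p) X"
  have "rhat X f (p \<star> (s *\<^sub>R Y)) = (\<Sum>b\<in>Basis. of_real (Ad ((- s) *\<^sub>R Y) W \<bullet> b) * hat b f (p \<star> (s *\<^sub>R Y)))" for s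
    unfolding rhat_eq inv_gmul Ad_Ad W_def
    by (subst linear_basis_expand[OF hat_linear[OF f]]) simp
  moreover have "((\<lambda>s. of_real (Ad ((- s) *\<^sub>R Y) W \<bullet> b) * hat b f (p \<star> (s *\<^sub>R Y))) has_vector_derivative
     of_real (W \<bullet> b) * hat Y (hat b f) p + of_real (- br Y W \<bullet> b) * hat b f p) (at 0)" for b
  proof -
    have "((\<lambda>s. Ad ((- s) *\<^sub>R Y) W) has_vector_derivative - br Y W) (at 0)"
      using br_eq_Ad_derivative[of "- Y" W] by (simp add: bilinear_lneg[OF bilinear_br])
    from bounded_linear.has_vector_derivative[OF bounded_linear_inner_left this]
    have "((\<lambda>s. of_real (Ad ((- s) *\<^sub>R Y) W \<bullet> b)) has_vector_derivative complex_of_real (- br Y W \<bullet> b)) (at 0)"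
      by (intro has_vector_derivative_of_real) (simp add: has_real_derivative_iff_has_vector_derivative)
    from has_vector_derivative_mult[OF this hat_along_0[OF hat_R[OF f]]] show ?thesis by simp
  qed
  ultimately have "((\<lambda>s. rhat X f (p \<star> (s *\<^sub>R Y))) has_vector_derivative
      (\<Sum>b\<in>Basis. of_real (W \<bullet> b) * hat Y (hat b f) p + of_real (- br Y W \<bullet> b) * hat b f p)) (at 0)"
    by (simp only:) (intro has_vector_derivative_sum)
  from vector_derivative_unique_at[OF hat_along_0[OF rhat_R[OF f]] this]
  have "hat Y (rhat X f) p = (\<Sum>b\<in>Basis. of_real (W \<bullet> b) * hat Y (hat b f) p) + hat (- br Y W) f p"
    by (simp only: sum.distrib linear_basis_expand[OF hat_linear[OF f, of p], of "- br Y W"])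
  also have "(\<Sum>b\<in>Basis. of_real (W \<bullet> b) * hat Y (hat b f) p) =
      (\<Sum>b\<in>Basis. of_real (W \<bullet> b) * hat b (hat Y f) p) + (\<Sum>b\<in>Basis. of_real (W \<bullet> b) * hat (br Y b) f p)"
    by (simp add: hat_commutator_at[OF f, of Y] distrib_left sum.distrib)
  also have "(\<Sum>b\<in>Basis. of_real (W \<bullet> b) * hat b (hat Y f) p) = hat W (hat Y f) p"
    by (rule linear_basis_expand[OF hat_linear[OF hat_R[OF f]], symmetric])
  also have "(\<Sum>b\<in>Basis. of_real (W \<bullet> b) * hat (br Y b) f p) = hat (br Y W) f p"
    using linear_basis_expand[of "\<lambda>V. hat (br Y V) f p" W]
      linear_compose[OF _ hat_linear[OF f, of p], of "br Y"] bilinear_br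
    by (simp add: o_def bilinear_def)
  finally have "hat Y (rhat X f) p = hat W (hat Y f) p"
    using linear_neg[OF hat_linear[OF f, of p], of "br Y W"] by simp
  then show "rhat X (hat Y f) p = hat Y (rhat X f) p"
    by (simp add: rhat_eq[of X "hat Y f"] W_def)
qed

lemma hat_zero_invariant:
  assumes f: "f \<in> R" and z: "\<And>w. w \<in> F i \<Longrightarrow> hat w f = (\<lambda>_. 0)" and w: "w \<in> F i"
  shows "f (p + w) = f p"
proof -
  have "((\<lambda>t. f (p + t *\<^sub>R w)) has_vector_derivative 0) (at t)" for t
  proof -
    have "((\<lambda>t. p + t *\<^sub>R w) has_vector_derivative w) (at t)"
      by (auto intro!: derivative_eq_intros)
    then have "((\<lambda>t. f (p + t *\<^sub>R w)) has_vector_derivative frechet_derivative f (at (p + t *\<^sub>R w)) w) (at t)"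
      using vector_derivative_diff_chain_within[of "\<lambda>t. p + t *\<^sub>R w" w t UNIV f "frechet_derivative f (at (p + t *\<^sub>R w))"]
        A_has_derivative[OF f, of "p + t *\<^sub>R w"]
      by (simp add: o_def has_derivative_at_withinI)
    moreover have "frechet_derivative f (at q) w = hat (T q w) f q" for q
      by (simp add: hat_def Dv_def)
    ultimately show ?thesis using z[OF T_F[OF w]] by simp
  qed
  then obtain c where "\<And>t. f (p + t *\<^sub>R w) = c"
    using has_vector_derivative_zero_constant[of UNIV "\<lambda>t. f (p + t *\<^sub>R w)"] by auto
  from this[of 0] this[of 1] show ?thesis by simp
qed

lemma hat_zero_const:
  assumes f: "f \<in> R" and z: "\<And>X. hat X f = (\<lambda>_. 0)"
  shows "f = (\<lambda>_. f 0)"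
  using hat_zero_invariant[OF f, of 0 _ 0] z by auto

lemma rhat_zero_const:
  assumes f: "f \<in> R" and z: "\<And>X. rhat X f = (\<lambda>_. 0)"
  shows "f = (\<lambda>_. f 0)"
proof (rule hat_zero_const[OF f], rule ext)
  fix X p
  have "hat X f p = rhat (Ad p X) f p" by (simp add: rhat_eq)
  then show "hat X f p = 0" using z by simp
qed

end

section \<open>Subalgebras separating tangent vectors\<close>

context flag_group begin

definition Inv :: "'g set \<Rightarrow> ('g \<Rightarrow> complex) set" where
  "Inv U = {f \<in> R. \<forall>w\<in>U. hat w f = (\<lambda>_. 0)}"

lemma Inv_R: "f \<in> Inv U \<Longrightarrow> f \<in> R"
  and Inv_zero: "f \<in> Inv U \<Longrightarrow> w \<in> U \<Longrightarrow> hat w f = (\<lambda>_. 0)"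
  by (auto simp: Inv_def)

lemma InvI: "f \<in> R \<Longrightarrow> (\<And>w. w \<in> U \<Longrightarrow> hat w f = (\<lambda>_. 0)) \<Longrightarrow> f \<in> Inv U"
  by (auto simp: Inv_def)

lemma subalg_Inv: "subalg (Inv U)"
  unfolding subalg_def
proof (intro conjI allI ballI)
  show "(\<lambda>_. a) \<in> Inv U" for a
    by (intro InvI R_intros) (simp add: derivation_on_const[OF derivation_hat])
  fix f g assume "f \<in> Inv U" "g \<in> Inv U"
  note fg = this Inv_R[OF this(1)] Inv_R[OF this(2)]
  show "(\<lambda>x. f x + g x) \<in> Inv U"
    using fg by (intro InvI R_intros) (simp_all add: derivation_on_add[OF derivation_hat] Inv_zero)
  show "(\<lambda>x. f x * g x) \<in> Inv U"
    using fg by (intro InvI R_intros) (simp_all add: derivation_on_mult[OF derivation_hat] Inv_zero)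
qed

lemma hat_cnj: "f \<in> R \<Longrightarrow> hat X (\<lambda>p. cnj (f p)) = (\<lambda>p. cnj (hat X f p))"
  unfolding hat_def by (rule Dv_cnj)

lemma rhat_cnj: "f \<in> R \<Longrightarrow> rhat X (\<lambda>p. cnj (f p)) = (\<lambda>p. cnj (rhat X f p))"
  unfolding rhat_def by (rule Dv_cnj)

lemma Inv_cnj: "f \<in> Inv U \<Longrightarrow> (\<lambda>p. cnj (f p)) \<in> Inv U"
  by (intro InvI cnj_A) (auto simp: hat_cnj Inv_R Inv_zero)

lemma hat_add: "f \<in> R \<Longrightarrow> hat (X + Y) f = (\<lambda>p. hat X f p + hat Y f p)"
  using linear_add[OF hat_linear] by blast

lemma hat_diff: "f \<in> R \<Longrightarrow> hat (X - Y) f = (\<lambda>p. hat X f p - hat Y f p)"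
  using linear_diff[OF hat_linear] by blast

lemma hat_scale: "f \<in> R \<Longrightarrow> hat (c *\<^sub>R X) f = (\<lambda>p. of_real c * hat X f p)"
  using linear_cmul[OF hat_linear] by (auto simp: scaleR_conv_of_real)

lemma hat_0: "f \<in> R \<Longrightarrow> hat 0 f = (\<lambda>_. 0)"
  using linear_0[OF hat_linear] by blast

lemma exists_rhat_reduced:
  assumes S: "\<And>X f. f \<in> S \<Longrightarrow> rhat X f \<in> S" and "f \<in> S" "f \<in> R" "f \<notin> Inv U"
  shows "\<exists>g\<in>S. g \<notin> Inv U \<and> g \<in> R \<and> (\<forall>X. rhat X g \<in> Inv U)"
proof -
  obtain d where "f \<in> nilset rhat R d" using rhat_nil assms(3) by blast
  then show ?thesis using assms(2-4)
  proof (induction d arbitrary: f)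
    case 0
    then show ?case using subalg_const[OF subalg_Inv, of 0 U] by simp
  next
    case (Suc d)
    show ?case
    proof (cases "\<forall>X. rhat X f \<in> Inv U")
      case False
      then obtain X where "rhat X f \<notin> Inv U" by blast
      then show ?thesis using Suc.IH[of "rhat X f"] Suc.prems S rhat_R by auto
    qed (use Suc.prems in blast)
  qed
qed

lemma exists_real_rhat_reduced:
  assumes S: "subalg S" "\<And>X f. f \<in> S \<Longrightarrow> rhat X f \<in> S" "\<And>f. f \<in> S \<Longrightarrow> (\<lambda>p. cnj (f p)) \<in> S"
    and "f \<in> S" "f \<in> R" "f \<notin> Inv U"
  shows "\<exists>g\<in>S. g \<notin> Inv U \<and> g \<in> R \<and> (\<forall>X. rhat X g \<in> Inv U) \<and> (\<lambda>p. cnj (g p)) = g"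
proof -
  obtain g where g: "g \<in> S" "g \<notin> Inv U" "g \<in> R" "\<And>X. rhat X g \<in> Inv U"
    using exists_rhat_reduced[OF S(2) assms(4-6)] by blast
  have c: "(\<lambda>p. cnj (g p)) \<in> R" by (rule cnj_A[OF g(3)])
  have comb: "(\<lambda>p. a * g p + b * cnj (g p)) \<in> S \<and> (\<lambda>p. a * g p + b * cnj (g p)) \<in> R \<and>
      (\<forall>X. rhat X (\<lambda>p. a * g p + b * cnj (g p)) \<in> Inv U)" for a b
  proof (intro conjI allI)
    show "(\<lambda>p. a * g p + b * cnj (g p)) \<in> S"
      by (intro subalg_add[OF S(1)] subalg_cmult[OF S(1)] S(3) g)
    show "(\<lambda>p. a * g p + b * cnj (g p)) \<in> R" by (intro R_intros g c)
    fix X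
    have "rhat X (\<lambda>p. a * g p + b * cnj (g p)) = (\<lambda>p. a * rhat X g p + b * cnj (rhat X g p))"
      using derivation_on_add[OF derivation_rhat, of "\<lambda>p. a * g p" "\<lambda>p. b * cnj (g p)" X]
        derivation_on_cmult[OF subalg_A derivation_rhat] g(3) c
      by (simp add: R_intros rhat_cnj)
    also have "\<dots> \<in> Inv U"
      by (intro subalg_add[OF subalg_Inv] subalg_cmult[OF subalg_Inv] Inv_cnj g)
    finally show "rhat X (\<lambda>p. a * g p + b * cnj (g p)) \<in> Inv U" .
  qed
  define g1 where "g1 p = (1/2) * g p + (1/2) * cnj (g p)" for p
  define g2 where "g2 p = (- \<i>/2) * g p + (\<i>/2) * cnj (g p)" for p
  have "g = (\<lambda>p. g1 p + \<i> * g2 p)"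
    by (auto simp: g1_def g2_def algebra_simps)
  then have "g1 \<notin> Inv U \<or> g2 \<notin> Inv U"
    using g(2) subalg_add[OF subalg_Inv, of g1 U "\<lambda>p. \<i> * g2 p"] subalg_cmult[OF subalg_Inv, of g2 U \<i>]
    by auto
  moreover have "(\<lambda>p. cnj (g1 p)) = g1" "(\<lambda>p. cnj (g2 p)) = g2"
    by (auto simp: g1_def g2_def)
  moreover have "g1 \<in> S \<and> g1 \<in> R \<and> (\<forall>X. rhat X g1 \<in> Inv U)" "g2 \<in> S \<and> g2 \<in> R \<and> (\<forall>X. rhat X g2 \<in> Inv U)"
    using comb[of "1/2" "1/2"] comb[of "- \<i>/2" "\<i>/2"] by (simp_all add: g1_def[abs_def] g2_def[abs_def])
  ultimately show ?thesis by blast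
qed

text \<open>An algebraic form of the closedness of unipotent orbits: the subalgebra \<open>S\<close> contains the
  invariants of a decreasing chain of subalgebras \<open>U\<close>, each the kernel of a real character given by
  some \<open>g \<in> S\<close> on the previous one.\<close>

theorem separating_subalg_full:
  assumes S: "subalg S" "S \<subseteq> R" "\<And>X f. f \<in> S \<Longrightarrow> rhat X f \<in> S" "\<And>f. f \<in> S \<Longrightarrow> (\<lambda>p. cnj (f p)) \<in> S"
    and sep: "\<And>v. v \<noteq> 0 \<Longrightarrow> \<exists>f\<in>S. hat v f \<noteq> (\<lambda>_. 0)"
  shows "R \<subseteq> S"
proof -
  have "R \<subseteq> S" if "subspace U" "\<And>x y. x \<in> U \<Longrightarrow> y \<in> U \<Longrightarrow> br x y \<in> U" "Inv U \<subseteq> S" for U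
    using that
  proof (induction "dim U" arbitrary: U rule: less_induct)
    case less
    show ?case
    proof (cases "U = {0}")
      case True
      then have "R \<subseteq> Inv U" using hat_0 by (auto intro: InvI)
      then show ?thesis using less.prems by blast
    next
      case False
      then obtain v where v: "v \<in> U" "v \<noteq> 0" using subspace_0[OF less.prems(1)] by blast
      then obtain f where "f \<in> S" "hat v f \<noteq> (\<lambda>_. 0)" using sep by blast
      then have "f \<in> S" "f \<in> R" "f \<notin> Inv U" using S(2) v Inv_zero by auto
      then obtain g where g: "g \<in> S" "g \<notin> Inv U" "g \<in> R" "\<And>X. rhat X g \<in> Inv U" "(\<lambda>p. cnj (g p)) = g"
        using exists_real_rhat_reduced[OF S(1,3,4)] by blast
      define \<psi> where "\<psi> w = Re (hat w g 0)" for w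
      have \<psi>: "hat w g = (\<lambda>_. of_real (\<psi> w))" if "w \<in> U" for w
      proof -
        have "rhat X (hat w g) = (\<lambda>_. 0)" for X
          using rhat_hat_commute[OF g(3)] Inv_zero[OF g(4) that] by simp
        then have c: "hat w g = (\<lambda>_. hat w g 0)" by (rule rhat_zero_const[OF hat_R[OF g(3)]])
        have "cnj (hat w g 0) = hat w g 0"
          using hat_cnj[OF g(3), of w] g(5) by metis
        then have "hat w g 0 = of_real (\<psi> w)" by (simp add: \<psi>_def complex_eq_iff)
        with c show ?thesis by metis
      qed
      define U' where "U' = {w \<in> U. hat w g = (\<lambda>_. 0)}"
      have sub: "subspace U'"
        using less.prems(1) g(3)
        by (auto simp: U'_def subspace_def hat_0 hat_add hat_scale)
      have brU': "br x y \<in> U'" if "x \<in> U" "y \<in> U" for x y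
      proof -
        have "hat (br x y) g p = 0" for p
          using hat_commutator_at[OF g(3), of x y p]
          unfolding \<psi>[OF that(1)] \<psi>[OF that(2)] derivation_on_const[OF derivation_hat] by simp
        then have "hat (br x y) g = (\<lambda>_. 0)" by blast
        then show ?thesis using less.prems(2) that by (simp add: U'_def)
      qed
      obtain w0 where w0: "w0 \<in> U" "hat w0 g \<noteq> (\<lambda>_. 0)"
        using g(2,3) InvI by blast
      then have "\<psi> w0 \<noteq> 0" using \<psi> by auto
      define W where "W = (1 / \<psi> w0) *\<^sub>R w0"
      have W: "W \<in> U" "hat W g = (\<lambda>_. 1)"
        using subspace_scale[OF less.prems(1) w0(1)] \<psi>[OF w0(1)] \<open>\<psi> w0 \<noteq> 0\<close>
        by (simp_all add: W_def hat_scale[OF g(3)])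
      have "U' \<subset> U" using w0 by (auto simp: U'_def)
      then have "dim U' < dim U"
        using sub less.prems(1) by (intro dim_psubset) (simp add: span_eq_iff[THEN iffD2])
      moreover have "Inv U' \<subseteq> S"
      proof
        fix f assume f: "f \<in> Inv U'"
        have D: "derivation_on (Inv U') (hat W)"
        proof (rule derivation_on_subset[OF derivation_hat])
          show "Inv U' \<subseteq> R" by (auto intro: Inv_R)
          fix f assume f: "f \<in> Inv U'"
          show "hat W f \<in> Inv U'"
          proof (rule InvI[OF hat_R[OF Inv_R[OF f]]])
            fix w assume w: "w \<in> U'"
            then have "br w W \<in> U'" using brU' W(1) by (simp add: U'_def)
            then show "hat w (hat W f) = (\<lambda>_. 0)"
              using hat_commutator[OF Inv_R[OF f], of w W] Inv_zero[OF f w] Inv_zero[OF f, of "br w W"]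
                derivation_on_const[OF derivation_hat] by simp
          qed
        qed
        have gI: "g \<in> Inv U'" using g(3) by (auto simp: U'_def intro: InvI)
        obtain d where "(hat W ^^ d) f = (\<lambda>_. 0)" using hat_funpow_zero[OF Inv_R[OF f]] by blast
        from slice_expansion[OF subalg_Inv D gI W(2) f this]
        obtain r k where k: "\<And>l. k l \<in> Inv U'" "\<And>l. hat W (k l) = (\<lambda>_. 0)" "f = (\<lambda>x. \<Sum>l<r. k l x * g x ^ l)"
          by blast
        have "k l \<in> Inv U" for l
        proof (rule InvI[OF Inv_R[OF k(1)]])
          fix w assume w: "w \<in> U"
          have kR: "k l \<in> R" by (rule Inv_R[OF k(1)])
          have wd: "w - \<psi> w *\<^sub>R W \<in> U'"
            using w W less.prems(1) \<psi>[OF w] g(3)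
            by (auto simp: U'_def subspace_diff subspace_scale hat_diff hat_scale)
          have "hat ((w - \<psi> w *\<^sub>R W) + \<psi> w *\<^sub>R W) (k l) = (\<lambda>_. 0)"
            unfolding hat_add[OF kR] hat_scale[OF kR] using k(2) Inv_zero[OF k(1) wd] by simp
          then show "hat w (k l) = (\<lambda>_. 0)" by simp
        qed
        then show "f \<in> S" unfolding k(3) using less.prems(3)
          by (intro subalg_sum[OF S(1)] subalg_mult[OF S(1)] subalg_power[OF S(1)] g(1)) auto
      qed
      ultimately show ?thesis
        using less.hyps[of U'] sub brU' by (auto simp: U'_def)
    qed
  qed
  moreover have "Inv UNIV \<subseteq> S"
  proof
    fix f assume "f \<in> Inv UNIV"
    then have "f = (\<lambda>_. f 0)" by (intro hat_zero_const) (auto simp: Inv_def)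
    then show "f \<in> S" using subalg_const[OF S(1), of "f 0"] by simp
  qed
  ultimately show ?thesis using subspace_UNIV by blast
qed

end

section \<open>CR polynomials\<close>

locale cr_group = flag_group gmul br e m
  for gmul :: "'g::euclidean_space \<Rightarrow> 'g \<Rightarrow> 'g" (infixl "\<star>" 70) and br e m +
  fixes h :: "'g set" and J :: "'g \<Rightarrow> 'g"
  assumes subspace_h: "subspace h"
    and J_lin: "\<And>x y c. x \<in> h \<Longrightarrow> y \<in> h \<Longrightarrow> J (x + c *\<^sub>R y) = J x + c *\<^sub>R J y"
    and J_h: "\<And>x. x \<in> h \<Longrightarrow> J x \<in> h"
    and J_J: "\<And>x. x \<in> h \<Longrightarrow> J (J x) = - x"
    and integrable: "\<And>X Y. X \<in> h \<Longrightarrow> Y \<in> h \<Longrightarrow> br X Y - br (J X) (J Y) \<in> h \<and>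
        br X (J Y) + br (J X) Y = J (br X Y - br (J X) (J Y))"
begin

lemma J_0: "J 0 = 0"
  using J_lin[of 0 0 1] subspace_0[OF subspace_h] by simp

lemma J_add: "x \<in> h \<Longrightarrow> y \<in> h \<Longrightarrow> J (x + y) = J x + J y"
  using J_lin[of x y 1] by simp

lemma J_scale: "x \<in> h \<Longrightarrow> J (c *\<^sub>R x) = c *\<^sub>R J x"
  using J_lin[of 0 x c] subspace_0[OF subspace_h] J_0 by simp

lemma J_diff: "x \<in> h \<Longrightarrow> y \<in> h \<Longrightarrow> J (x - y) = J x - J y"
  using J_lin[of x y "-1"] by simp

definition Zh :: "'g \<Rightarrow> ('g \<Rightarrow> complex) \<Rightarrow> 'g \<Rightarrow> complex" where
  "Zh X f p = hat X f p + \<i> * hat (J X) f p"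

lemma derivation_Zh: "derivation_on R (Zh X)"
  unfolding derivation_on_def Zh_def[abs_def]
  by (auto intro!: R_intros hat_R simp: derivation_on_const[OF derivation_hat]
      derivation_on_add[OF derivation_hat] derivation_on_mult[OF derivation_hat] algebra_simps)

lemmas Zh_R = derivation_on_closed[OF derivation_Zh]

lemma hat_Zh_commutator:
  assumes f: "f \<in> R"
  shows "hat w (Zh X f) p = Zh X (hat w f) p + hat (br w X) f p + \<i> * hat (br w (J X)) f p"
proof -
  have "hat w (Zh X f) p = hat w (hat X f) p + \<i> * hat w (hat (J X) f) p"
    unfolding Zh_def[abs_def]
    by (simp add: derivation_on_add[OF derivation_hat] derivation_on_cmult[OF subalg_A derivation_hat]
        hat_R[OF f] R_intros)
  then show ?thesis
    using hat_commutator_at[OF f, of w X p] hat_commutator_at[OF f, of w "J X" p]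
    by (simp add: Zh_def algebra_simps)
qed

lemma Zh_commutator:
  assumes f: "f \<in> R" and X: "X \<in> h" and Y: "Y \<in> h"
  shows "Zh X (Zh Y f) p = Zh Y (Zh X f) p + Zh (br X Y - br (J X) (J Y)) f p"
proof -
  have *: "Zh Y (Zh X f) p = Zh Y (hat X f) p + \<i> * Zh Y (hat (J X) f) p"
    unfolding Zh_def[of X, abs_def]
    by (simp add: derivation_on_add[OF derivation_Zh] derivation_on_cmult[OF subalg_A derivation_Zh]
        hat_R[OF f] R_intros)
  have "Zh X (Zh Y f) p = hat X (Zh Y f) p + \<i> * hat (J X) (Zh Y f) p"
    by (rule Zh_def)
  also have "\<dots> = Zh Y (Zh X f) p + (hat (br X Y) f p - hat (br (J X) (J Y)) f p) +
      \<i> * (hat (br X (J Y)) f p + hat (br (J X) Y) f p)"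
    unfolding * hat_Zh_commutator[OF f] by (simp add: algebra_simps)
  also have "hat (br X (J Y)) f p + hat (br (J X) Y) f p = hat (br X (J Y) + br (J X) Y) f p"
    by (simp add: hat_add[OF f])
  also have "hat (br X Y) f p - hat (br (J X) (J Y)) f p = hat (br X Y - br (J X) (J Y)) f p"
    by (simp add: hat_diff[OF f])
  finally show ?thesis using integrable[OF X Y] by (simp add: Zh_def[of "br X Y - br (J X) (J Y)"])
qed

lemma Zh_add: "f \<in> R \<Longrightarrow> X \<in> h \<Longrightarrow> Y \<in> h \<Longrightarrow> Zh (X + Y) f p = Zh X f p + Zh Y f p"
  by (simp add: Zh_def J_add hat_add algebra_simps)

text \<open>The scalar action of \<open>c\<close> for which \<open>X \<mapsto> X + \<i> J X\<close> is complex linear, so \<open>\<i>\<close> acts as \<open>- J\<close>.\<close>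

definition csc :: "complex \<Rightarrow> 'g \<Rightarrow> 'g" where
  "csc c X = Re c *\<^sub>R X - Im c *\<^sub>R J X"

lemma csc_h: "X \<in> h \<Longrightarrow> csc c X \<in> h"
  by (simp add: csc_def subspace_diff subspace_scale subspace_h J_h)

lemma J_csc: "X \<in> h \<Longrightarrow> J (csc c X) = Re c *\<^sub>R J X + Im c *\<^sub>R X"
  by (simp add: csc_def J_diff J_scale J_h J_J subspace_scale subspace_h)

lemma Zh_csc: "f \<in> R \<Longrightarrow> X \<in> h \<Longrightarrow> Zh (csc c X) f p = c * Zh X f p"
  unfolding Zh_def J_csc
  by (subst (3) complex_eq[of c])
     (simp add: csc_def hat_diff hat_add hat_scale algebra_simps)

text \<open>The \<open>X\<close> whose (0,1) vector \<open>X + \<i> J X\<close> lies in the complexification of \<open>F j\<close>.\<close>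

definition hj :: "nat \<Rightarrow> 'g set" where
  "hj j = {X \<in> h. X \<in> F j \<and> J X \<in> F j}"

definition mu :: "nat \<Rightarrow> 'g \<Rightarrow> complex" where
  "mu j X = Complex (e j \<bullet> X) (e j \<bullet> J X)"

definition skipped :: "nat \<Rightarrow> bool" where
  "skipped j \<longleftrightarrow> (\<exists>X\<in>hj j. mu j X \<noteq> 0)"

lemma hj_0: "hj 0 = h"
  by (simp add: hj_def)

lemma hj_h: "X \<in> hj j \<Longrightarrow> X \<in> h"
  by (simp add: hj_def)

lemma subspace_hj: "subspace (hj j)"
  unfolding subspace_def hj_def
  using subspace_h subspace_F[of j] by (auto simp: subspace_def J_0 J_add J_scale)

lemma hj_Suc: "X \<in> hj (Suc j) \<longleftrightarrow> X \<in> hj j \<and> mu j X = 0"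
  by (auto simp: hj_def mu_def F_Suc complex_eq_iff)

lemma J_hj: "X \<in> hj j \<Longrightarrow> J X \<in> hj j"
  using subspace_neg[OF subspace_F] by (auto simp: hj_def J_h J_J)

lemma csc_hj: "X \<in> hj j \<Longrightarrow> csc c X \<in> hj j"
  unfolding csc_def by (intro subspace_diff subspace_scale subspace_hj J_hj)

lemma mu_csc: "X \<in> h \<Longrightarrow> mu j (csc c X) = c * mu j X"
  by (simp add: mu_def complex_eq_iff J_csc) (simp add: csc_def inner_diff_right inner_add_right algebra_simps)

lemma mu_diff: "X \<in> h \<Longrightarrow> Y \<in> h \<Longrightarrow> mu j (X - Y) = mu j X - mu j Y"
  by (simp add: mu_def complex_eq_iff J_diff inner_diff_right)

lemma hj_split:
  assumes "X \<in> hj j" "mu j X \<noteq> 0" "Y \<in> hj j"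
  shows "Y - csc (mu j Y / mu j X) X \<in> hj (Suc j)"
  using assms subspace_diff[OF subspace_hj] csc_hj csc_h hj_h
  by (simp add: hj_Suc mu_diff mu_csc)

lemma hj_br:
  assumes "X \<in> h" "Y \<in> hj j"
  shows "br X Y - br (J X) (J Y) \<in> hj (Suc j)" "br Y X - br (J Y) (J X) \<in> hj (Suc j)"
proof -
  have Y: "Y \<in> h" "Y \<in> F j" "J Y \<in> F j" using assms by (auto simp: hj_def)
  note F = br_F[OF Y(2)] br_F[OF Y(3)] br_F_left[OF Y(2)] br_F_left[OF Y(3)]
  show "br X Y - br (J X) (J Y) \<in> hj (Suc j)"
    using integrable[OF assms(1) Y(1)] F subspace_diff[OF subspace_F] subspace_add[OF subspace_F]
    unfolding hj_def by (metis (mono_tags, lifting) mem_Collect_eq)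
  show "br Y X - br (J Y) (J X) \<in> hj (Suc j)"
    using integrable[OF Y(1) assms(1)] F subspace_diff[OF subspace_F] subspace_add[OF subspace_F]
    unfolding hj_def by (metis (mono_tags, lifting) mem_Collect_eq)
qed

lemma hat_xc: "w \<in> F j \<Longrightarrow> hat w (xc j) = (\<lambda>_. of_real (e j \<bullet> w))"
  by (simp add: hat_def Dv_xc e_lvf)

lemma Zh_xc: "X \<in> hj j \<Longrightarrow> Zh X (xc j) = (\<lambda>_. mu j X)"
  by (auto simp: hj_def Zh_def[abs_def] hat_xc mu_def complex_eq_iff)

lemma Zh_funpow_zero: "f \<in> R \<Longrightarrow> \<exists>d. (Zh X ^^ d) f = (\<lambda>_. 0)"
proof -
  have "f \<in> nilset hat R d \<Longrightarrow> (Zh X ^^ d) f = (\<lambda>_. 0)" for d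
  proof (induction d arbitrary: f)
    case (Suc d)
    have "Zh X f \<in> nilset hat R d"
      using Suc.prems unfolding Zh_def[abs_def]
      by (intro nilset_add[where D=hat, OF subalg_A derivation_hat]
          nilset_cmult[where D=hat, OF subalg_A derivation_hat]) auto
    then show ?case using Suc.IH by (simp add: funpow_Suc_right del: funpow.simps)
  qed simp
  then show "f \<in> R \<Longrightarrow> \<exists>d. (Zh X ^^ d) f = (\<lambda>_. 0)" using hat_nil by blast
qed

definition RK :: "('g \<Rightarrow> complex) set" where
  "RK = {f \<in> R. \<forall>X\<in>h. Zh X f = (\<lambda>_. 0)}"

lemma subalg_Zh_ker: "subalg {f \<in> R. \<forall>X\<in>U. Zh X f = (\<lambda>_. 0)}"
  unfolding subalg_def
  by (auto intro!: R_intros simp: derivation_on_const[OF derivation_Zh]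
      derivation_on_add[OF derivation_Zh] derivation_on_mult[OF derivation_Zh])

lemma subalg_RK: "subalg RK"
  unfolding RK_def by (rule subalg_Zh_ker)

lemma cr_coordinate_exists_aux:
  assumes i: "i < m" "\<not> skipped i" and j: "j \<le> i"
  shows "\<exists>u\<in>R. (\<forall>w\<in>F i. hat w u = (\<lambda>_. of_real (e i \<bullet> w))) \<and> (\<forall>X\<in>hj j. Zh X u = (\<lambda>_. 0))"
  using j
proof (induction j rule: inc_induct)
  case base
  show ?case
    using i by (intro bexI[of _ "xc i"]) (auto simp: hat_xc Zh_xc skipped_def intro: xc_A)
next
  case (step j)
  then obtain u where u: "u \<in> R" "\<And>w. w \<in> F i \<Longrightarrow> hat w u = (\<lambda>_. of_real (e i \<bullet> w))"
      "\<And>X. X \<in> hj (Suc j) \<Longrightarrow> Zh X u = (\<lambda>_. 0)" by blast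
  show ?case
  proof (cases "skipped j")
    case False
    then have "hj j \<subseteq> hj (Suc j)" by (auto simp: hj_Suc skipped_def)
    with u show ?thesis by blast
  next
    case True
    then obtain X where X: "X \<in> hj j" "mu j X \<noteq> 0" by (auto simp: skipped_def)
    note Xh = hj_h[OF X(1)]
    define M where "M = {f \<in> R. \<forall>Y\<in>hj (Suc j). Zh Y f = (\<lambda>_. 0)} \<inter> Inv (F i)"
    have M: "subalg M" unfolding M_def by (intro subalg_Int subalg_Zh_ker subalg_Inv)
    have ZM: "Zh Y (Zh X f) = (\<lambda>_. 0)"
      if f: "f \<in> R" "\<forall>Y\<in>hj (Suc j). Zh Y f = (\<lambda>_. 0)" and Y: "Y \<in> hj (Suc j)" for f Y
    proof
      fix p
      have "br Y X - br (J Y) (J X) \<in> hj (Suc j)"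
        using hj_br(2)[OF Xh, of Y j] Y by (simp add: hj_Suc)
      then show "Zh Y (Zh X f) p = 0"
        using Zh_commutator[OF f(1) hj_h[OF Y] Xh, of p] f(2) Y
        by (simp add: derivation_on_const[OF derivation_Zh])
    qed
    have D: "derivation_on M (Zh X)"
    proof (rule derivation_on_subset[OF derivation_Zh])
      show "M \<subseteq> R" by (auto simp: M_def)
      fix f assume "f \<in> M"
      then have f: "f \<in> R" "\<forall>Y\<in>hj (Suc j). Zh Y f = (\<lambda>_. 0)" "f \<in> Inv (F i)" by (auto simp: M_def)
      have "hat w (Zh X f) = (\<lambda>_. 0)" if w: "w \<in> F i" for w
      proof
        fix p
        have "br w Y \<in> F i" for Y using br_F_left[OF w] F_mono[of i "Suc i"] by auto
        then show "hat w (Zh X f) p = 0"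
          using hat_Zh_commutator[OF f(1), of w X p] Inv_zero[OF f(3)] w
          by (simp add: derivation_on_const[OF derivation_Zh])
      qed
      then show "Zh X f \<in> M"
        using ZM[OF f(1,2)] Zh_R[OF f(1)] by (auto simp: M_def intro: InvI)
    qed
    define s where "s p = inverse (mu j X) * xc j p" for p
    have jm: "xc j \<in> R" using step i by (intro xc_A) auto
    have Fi: "F i \<subseteq> F (Suc j)" using step by (intro F_mono) auto
    have s: "s \<in> M" "Zh X s = (\<lambda>_. 1)"
    proof -
      show "Zh X s = (\<lambda>_. 1)"
        unfolding s_def[abs_def] using X
        by (simp add: derivation_on_cmult[OF subalg_A derivation_Zh jm] Zh_xc)
      have "xc j \<in> M"
        using jm Fi by (auto simp: M_def Inv_def hj_Suc Zh_xc hat_xc F_Suc)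
      then show "s \<in> M" unfolding s_def[abs_def] by (rule subalg_cmult[OF M])
    qed
    have "Zh X u \<in> M"
    proof -
      have "hat w (Zh X u) = (\<lambda>_. 0)" if w: "w \<in> F i" for w
      proof
        fix p
        have "br w Y \<in> F (Suc i)" for Y by (rule br_F_left[OF w])
        then have "hat (br w Y) u = (\<lambda>_. 0)" for Y using u(2)[of "br w Y"] by (simp add: F_Suc)
        then show "hat w (Zh X u) p = 0"
          using hat_Zh_commutator[OF u(1), of w X p] u(2)[OF w]
          by (simp add: derivation_on_const[OF derivation_Zh])
      qed
      then show ?thesis
        using ZM[OF u(1)] u(3) Zh_R[OF u(1)] by (auto simp: M_def intro: InvI)
    qed
    moreover obtain d where "(Zh X ^^ d) (Zh X u) = (\<lambda>_. 0)"
      using Zh_funpow_zero[OF Zh_R[OF u(1)]] by blast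
    ultimately obtain v where v: "v \<in> M" "Zh X v = Zh X u"
      using slice_surj[OF M D s] by blast
    then have vR: "v \<in> R" by (simp add: M_def)
    define u' where "u' p = u p - v p" for p
    have u'R: "u' \<in> R" unfolding u'_def[abs_def] by (intro R_intros u vR)
    have Zu': "Zh Y u' = (\<lambda>p. Zh Y u p - Zh Y v p)" for Y
      unfolding u'_def[abs_def] by (rule derivation_on_diff[OF subalg_A derivation_Zh u(1) vR])
    have "hat w u' = (\<lambda>_. of_real (e i \<bullet> w))" if w: "w \<in> F i" for w
      unfolding u'_def[abs_def]
      using derivation_on_diff[OF subalg_A derivation_hat u(1) vR] u(2)[OF w] v(1) w
      by (simp add: M_def Inv_zero[of v "F i" w])
    moreover have "Zh Y u' = (\<lambda>_. 0)" if Y: "Y \<in> hj j" for Y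
    proof
      fix p
      define c where "c = mu j Y / mu j X"
      have Y': "Y - csc c X \<in> hj (Suc j)" unfolding c_def by (rule hj_split[OF X Y])
      have "Zh Y u' p = Zh ((Y - csc c X) + csc c X) u' p" by simp
      also have "\<dots> = Zh (Y - csc c X) u' p + c * Zh X u' p"
        by (simp only: Zh_add[OF u'R hj_h[OF Y'] csc_h[OF Xh]] Zh_csc[OF u'R Xh])
      also have "\<dots> = 0"
        using u(3)[OF Y'] v Y' by (simp add: Zu' M_def)
      finally show "Zh Y u' p = 0" .
    qed
    ultimately show ?thesis using u'R by blast
  qed
qed

lemma cr_coordinate_exists:
  assumes "i < m" "\<not> skipped i"
  shows "\<exists>u. u \<in> RK \<and> (\<forall>w\<in>F i. hat w u = (\<lambda>_. of_real (e i \<bullet> w)))"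
  using cr_coordinate_exists_aux[OF assms, of 0] by (auto simp: RK_def hj_0)

definition u :: "nat \<Rightarrow> 'g \<Rightarrow> complex" where
  "u i = (SOME u. u \<in> RK \<and> (\<forall>w\<in>F i. hat w u = (\<lambda>_. of_real (e i \<bullet> w))))"

lemma u_RK: "i < m \<Longrightarrow> \<not> skipped i \<Longrightarrow> u i \<in> RK"
  and hat_u: "i < m \<Longrightarrow> \<not> skipped i \<Longrightarrow> w \<in> F i \<Longrightarrow> hat w (u i) = (\<lambda>_. of_real (e i \<bullet> w))"
  using someI_ex[OF cr_coordinate_exists] unfolding u_def by blast+

lemma RK_R: "f \<in> RK \<Longrightarrow> f \<in> R"
  and RK_zero: "f \<in> RK \<Longrightarrow> X \<in> h \<Longrightarrow> Zh X f = (\<lambda>_. 0)"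
  by (auto simp: RK_def)

lemma F_split: "i < m \<Longrightarrow> w \<in> F i \<Longrightarrow> w - (e i \<bullet> w) *\<^sub>R e i \<in> F (Suc i)"
  using orth[of i i] e_in_F[of i i] subspace_diff[OF subspace_F] subspace_scale[OF subspace_F]
  by (simp add: F_Suc inner_diff_right)

lemma RK_generated:
  "i \<le> m \<Longrightarrow> Inv (F i) \<inter> RK \<subseteq> alg_gen (u ` {j. j < i \<and> \<not> skipped j})"
proof (induction i)
  case 0
  show ?case
  proof
    fix f assume "f \<in> Inv (F 0) \<inter> RK"
    then have "f = (\<lambda>_. f 0)" by (intro hat_zero_const) (auto simp: Inv_def)
    then show "f \<in> alg_gen (u ` {j. j < 0 \<and> \<not> skipped j})" using alg_gen.const by metis
  qed
next
  case (Suc i)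
  then have im: "i < m" by simp
  have IH: "Inv (F i) \<inter> RK \<subseteq> alg_gen (u ` {j. j < Suc i \<and> \<not> skipped j})"
  proof -
    have "u ` {j. j < i \<and> \<not> skipped j} \<subseteq> u ` {j. j < Suc i \<and> \<not> skipped j}" by auto
    from alg_gen_mono[OF this] Suc.IH im show ?thesis by simp
  qed
  have InvF: "f \<in> Inv (F i)" if f: "f \<in> Inv (F (Suc i))" and z: "hat (e i) f = (\<lambda>_. 0)" for f
  proof (rule InvI[OF Inv_R[OF f]])
    fix w assume w: "w \<in> F i"
    have "hat ((w - (e i \<bullet> w) *\<^sub>R e i) + (e i \<bullet> w) *\<^sub>R e i) f = (\<lambda>_. 0)"
      unfolding hat_add[OF Inv_R[OF f]] hat_scale[OF Inv_R[OF f]]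
      using Inv_zero[OF f F_split[OF im w]] z by simp
    then show "hat w f = (\<lambda>_. 0)" by simp
  qed
  show ?case
  proof
    fix f assume f: "f \<in> Inv (F (Suc i)) \<inter> RK"
    then have fR: "f \<in> R" by (simp add: RK_R)
    show "f \<in> alg_gen (u ` {j. j < Suc i \<and> \<not> skipped j})"
    proof (cases "skipped i")
      case True
      then obtain X where X: "X \<in> hj i" "mu i X \<noteq> 0" by (auto simp: skipped_def)
      have "hat (e i) f p = 0" for p
      proof -
        have XF: "X \<in> F i" "J X \<in> F i" using X by (auto simp: hj_def)
        have hx: "hat w f p = of_real (e i \<bullet> w) * hat (e i) f p" if w: "w \<in> F i" for w
        proof -
          have "hat w f p = hat ((w - (e i \<bullet> w) *\<^sub>R e i) + (e i \<bullet> w) *\<^sub>R e i) f p" by simp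
          also have "\<dots> = of_real (e i \<bullet> w) * hat (e i) f p"
            unfolding hat_add[OF fR] hat_scale[OF fR] using f Inv_zero[OF _ F_split[OF im w]] by simp
          finally show ?thesis .
        qed
        have "Zh X f p = mu i X * hat (e i) f p"
          unfolding Zh_def hx[OF XF(1)] hx[OF XF(2)]
          by (simp add: mu_def Complex_eq algebra_simps)
        then show ?thesis using RK_zero[OF _ hj_h[OF X(1)]] f X(2) by simp
      qed
      then show ?thesis using InvF[of f] f IH by auto
    next
      case False
      note uK = u_RK[OF im False] and hu = hat_u[OF im False]
      define M where "M = Inv (F (Suc i)) \<inter> RK"
      have M: "subalg M" unfolding M_def by (intro subalg_Int subalg_RK subalg_Inv)
      have eF: "e i \<in> F i" by (rule e_in_F[OF order_refl im])
      have D: "derivation_on M (hat (e i))"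
      proof (rule derivation_on_subset[OF derivation_hat])
        show "M \<subseteq> R" by (auto simp: M_def intro: RK_R)
        fix f assume "f \<in> M"
        then have f: "f \<in> Inv (F (Suc i))" "f \<in> RK" "f \<in> R" by (auto simp: M_def RK_R)
        have z: "hat (br x (e i)) f = (\<lambda>_. 0)" "hat (br (e i) x) f = (\<lambda>_. 0)" for x
          using Inv_zero[OF f(1)] br_F[OF eF] br_F_left[OF eF] by blast+
        have "hat (e i) f \<in> Inv (F (Suc i))"
          using hat_commutator[OF f(3), of _ "e i"] Inv_zero[OF f(1)] hat_R[OF f(3)] z
          by (intro InvI) (simp_all add: derivation_on_const[OF derivation_hat])
        moreover have "hat (e i) f \<in> RK"
        proof -
          have "Zh X (hat (e i) f) p = 0" if "X \<in> h" for X p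
            using hat_Zh_commutator[OF f(3), of "e i" X p] RK_zero[OF f(2) that] z
            by (simp add: derivation_on_const[OF derivation_hat])
          then show ?thesis using hat_R[OF f(3)] by (auto simp: RK_def)
        qed
        ultimately show "hat (e i) f \<in> M" by (simp add: M_def)
      qed
      have uM: "u i \<in> M"
      proof -
        have "hat w (u i) = (\<lambda>_. 0)" if "w \<in> F (Suc i)" for w
          using hu[of w] that by (simp add: F_Suc)
        then show ?thesis using uK RK_R[OF uK] by (auto simp: M_def intro: InvI)
      qed
      have u1: "hat (e i) (u i) = (\<lambda>_. 1)" using hu[OF eF] orth[OF im im] by simp
      obtain d where "(hat (e i) ^^ d) f = (\<lambda>_. 0)" using hat_funpow_zero[OF fR] by blast
      from slice_expansion[OF M D uM u1 _ this] f
      obtain r k where k: "\<And>l. k l \<in> M" "\<And>l. hat (e i) (k l) = (\<lambda>_. 0)" "f = (\<lambda>x. \<Sum>l<r. k l x * u i x ^ l)"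
        by (auto simp: M_def)
      have "k l \<in> alg_gen (u ` {j. j < Suc i \<and> \<not> skipped j})" for l
        using k(1,2)[of l] InvF[of "k l"] IH by (auto simp: M_def)
      moreover have "u i \<in> alg_gen (u ` {j. j < Suc i \<and> \<not> skipped j})"
        using False by (intro alg_gen.base) auto
      ultimately show ?thesis unfolding k(3)
        by (intro subalg_sum[OF subalg_alg_gen] subalg_mult[OF subalg_alg_gen] subalg_power[OF subalg_alg_gen]) auto
    qed
  qed
qed

lemma RK_joint_kernel:
  assumes "i \<le> m" "v \<in> F i" "w \<in> F i" "\<And>f p. f \<in> RK \<Longrightarrow> hat v f p + \<i> * hat w f p = 0"
  shows "v \<in> h \<and> w = J v"
  using assms
proof (induction i arbitrary: v w rule: inc_induct)
  case base
  then show ?case using F_m subspace_0[OF subspace_h] J_0 by simp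
next
  case (step i)
  have im: "i < m" using step by simp
  show ?case
  proof (cases "skipped i")
    case False
    have "complex_of_real (e i \<bullet> v) + \<i> * of_real (e i \<bullet> w) = 0"
      using step.prems(3)[OF u_RK[OF im False]] hat_u[OF im False] step.prems by simp
    then have "e i \<bullet> v = 0" "e i \<bullet> w = 0" by (simp_all add: complex_eq_iff)
    then have "v \<in> F (Suc i)" "w \<in> F (Suc i)" using step.prems by (auto simp: F_Suc)
    then show ?thesis using step.IH step.prems(3) by blast
  next
    case True
    then obtain X where X: "X \<in> hj i" "mu i X \<noteq> 0" by (auto simp: skipped_def)
    define c where "c = Complex (e i \<bullet> v) (e i \<bullet> w) / mu i X"
    define Y where "Y = csc c X"
    have Y: "Y \<in> hj i" unfolding Y_def by (rule csc_hj[OF X(1)])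
    have Yh: "Y \<in> h" by (rule hj_h[OF Y])
    have "mu i Y = Complex (e i \<bullet> v) (e i \<bullet> w)"
      unfolding Y_def c_def using X by (simp add: mu_csc hj_h)
    then have eY: "e i \<bullet> Y = e i \<bullet> v" "e i \<bullet> J Y = e i \<bullet> w" by (simp_all add: mu_def)
    have "v - Y \<in> F (Suc i)" "w - J Y \<in> F (Suc i)"
      using step.prems Y eY subspace_diff[OF subspace_F] by (auto simp: F_Suc hj_def inner_diff_right)
    moreover have "hat (v - Y) f p + \<i> * hat (w - J Y) f p = 0" if f: "f \<in> RK" for f p
    proof -
      have "hat (v - Y) f p + \<i> * hat (w - J Y) f p = (hat v f p + \<i> * hat w f p) - Zh Y f p"
        by (simp add: hat_diff[OF RK_R[OF f]] Zh_def algebra_simps)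
      then show ?thesis
        using step.prems(3)[OF f, of p] RK_zero[OF f Yh] by simp
    qed
    ultimately have IH: "v - Y \<in> h \<and> w - J Y = J (v - Y)" by (rule step.IH)
    have "v \<in> h" using subspace_add[OF subspace_h, of "v - Y" Y] IH Yh by simp
    moreover have "w = J v" using IH J_diff[OF \<open>v \<in> h\<close> Yh] by simp
    ultimately show ?thesis by simp
  qed
qed

lemma RK_separates: "v \<noteq> 0 \<Longrightarrow> \<exists>f\<in>RK. hat v f \<noteq> (\<lambda>_. 0)"
proof (rule ccontr)
  assume v: "v \<noteq> 0" and "\<not> (\<exists>f\<in>RK. hat v f \<noteq> (\<lambda>_. 0))"
  then have "hat v f p + \<i> * hat 0 f p = 0" if "f \<in> RK" for f p
    using that by (simp add: hat_0 RK_R)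
  then have "v \<in> h \<and> 0 = J v"
    using RK_joint_kernel[of 0 v 0] by simp
  then have "v = 0" using J_J[of v] J_0 by simp
  then show False using v by simp
qed

lemma rhat_RK: "f \<in> RK \<Longrightarrow> rhat X f \<in> RK"
proof -
  assume f: "f \<in> RK"
  note fR = RK_R[OF f]
  have "Zh Y (rhat X f) p = 0" if Y: "Y \<in> h" for Y p
  proof -
    have "Zh Y (rhat X f) p = rhat X (\<lambda>p. hat Y f p + \<i> * hat (J Y) f p) p"
      by (simp add: Zh_def rhat_hat_commute[OF fR, symmetric] derivation_on_add[OF derivation_rhat]
          derivation_on_cmult[OF subalg_A derivation_rhat] hat_R[OF fR] R_intros)
    also have "(\<lambda>p. hat Y f p + \<i> * hat (J Y) f p) = (\<lambda>_. 0)"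
      using RK_zero[OF f Y] unfolding Zh_def[abs_def] .
    finally show ?thesis by (simp add: derivation_on_const[OF derivation_rhat])
  qed
  then show ?thesis using rhat_R[OF fR] by (auto simp: RK_def)
qed

abbreviation NS :: "nat set" where
  "NS \<equiv> {j. j < m \<and> \<not> skipped j}"

theorem R_generated: "R \<subseteq> alg_gen (u ` NS \<union> (\<lambda>j p. cnj (u j p)) ` NS)"
proof -
  define S where "S = alg_gen (RK \<union> (\<lambda>f p. cnj (f p)) ` RK)"
  have SA: "subalg S" by (simp add: S_def subalg_alg_gen)
  have RKS: "RK \<subseteq> S" by (auto simp: S_def intro: alg_gen.base)
  have SR: "S \<subseteq> R"
    unfolding S_def using RK_R cnj_A by (intro alg_gen_least subalg_A) auto
  have "R \<subseteq> S"
  proof (rule separating_subalg_full[OF SA SR])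
    show "\<exists>f\<in>S. hat v f \<noteq> (\<lambda>_. 0)" if "v \<noteq> 0" for v
      using RK_separates[OF that] RKS by blast
    show "(\<lambda>p. cnj (f p)) \<in> S" if "f \<in> S" for f
      using that unfolding S_def
    proof (induction rule: alg_gen.induct)
      case (base f)
      then show ?case by (intro alg_gen.base) (auto simp: image_iff)
    qed (auto intro: alg_gen.intros)
    show "rhat X f \<in> S" if "f \<in> S" for X f
      using that[unfolded S_def]
    proof (induction rule: alg_gen.induct)
      case (const a)
      then show ?case by (simp add: derivation_on_const[OF derivation_rhat] subalg_const[OF SA])
    next
      case (base f)
      then consider "f \<in> RK" | g where "g \<in> RK" "f = (\<lambda>p. cnj (g p))" by blast
      then show ?case
      proof cases
        case 2
        then show ?thesis using rhat_RK[OF 2(1), of X]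
          by (auto simp: rhat_cnj[OF RK_R] S_def intro!: alg_gen.base)
      qed (use rhat_RK RKS in blast)
    next
      case (add f g)
      then have "f \<in> S" "g \<in> S" by (simp_all add: S_def)
      then have "f \<in> R" "g \<in> R" using SR by blast+
      from derivation_on_add[OF derivation_rhat this] add.IH show ?case
        by (simp only: subalg_add[OF SA])
    next
      case (mult f g)
      then have fg: "f \<in> S" "g \<in> S" by (simp_all add: S_def)
      then have "f \<in> R" "g \<in> R" using SR by blast+
      from derivation_on_mult[OF derivation_rhat this] mult.IH fg show ?case
        by (simp only: subalg_add[OF SA] subalg_mult[OF SA])
    qed
  qed
  also have "S \<subseteq> alg_gen (u ` NS \<union> (\<lambda>j p. cnj (u j p)) ` NS)" (is "_ \<subseteq> ?G")
    unfolding S_def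
  proof (rule alg_gen_least[OF subalg_alg_gen])
    have "R \<subseteq> Inv (F m)" by (auto simp: F_m hat_0 intro: InvI)
    then have RKg: "RK \<subseteq> alg_gen (u ` NS)"
      using RK_generated[of m] RK_R by blast
    moreover have "alg_gen (u ` NS) \<subseteq> ?G" by (rule alg_gen_mono) auto
    moreover have "(\<lambda>p. cnj (f p)) \<in> ?G" if "f \<in> alg_gen (u ` NS)" for f
      using that by induction (auto intro: alg_gen.intros)
    ultimately show "RK \<union> (\<lambda>f p. cnj (f p)) ` RK \<subseteq> ?G" by blast
  qed
  finally show ?thesis .
qed

end

section \<open>Existence of flags and the embedding\<close>

context exp_group begin

lemma lcs_absorbs:
  assumes N: "subspace N" "\<And>x y. y \<in> N \<Longrightarrow> br x y \<in> N"
    and I: "I \<subseteq> span ({br x y | x y. y \<in> I} \<union> N)"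
  shows "I \<subseteq> span (N \<union> lcs br i)"
proof (induction i)
  case 0
  show ?case by simp
next
  case (Suc i)
  have "br x y \<in> span (N \<union> lcs br (Suc i))" if "y \<in> I" for x y
  proof -
    have "y \<in> span (N \<union> lcs br i)" using Suc that by blast
    then obtain a b where ab: "a \<in> span N" "b \<in> span (lcs br i)" "y = a + b"
      by (auto simp: span_Un)
    have "b \<in> lcs br i" using ab(2) by (cases i) (auto simp: span_span)
    moreover have "a \<in> N" using ab(1) N(1) by (simp add: span_eq_iff[THEN iffD2])
    ultimately have "br x a \<in> N" "br x b \<in> lcs br (Suc i)"
      using N(2) by (auto intro!: span_base)
    then show ?thesis
      unfolding ab(3) bilinear_radd[OF bilinear_br] by (intro span_add span_base) auto
  qed
  then have "{br x y | x y. y \<in> I} \<union> N \<subseteq> span (N \<union> lcs br (Suc i))"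
    by (auto intro: span_base)
  then show ?case using I span_minimal[OF _ subspace_span] by blast
qed

lemma flag_exists_aux:
  assumes nil: "nilpotent_lie br" and N: "subspace N" "\<And>x y. y \<in> N \<Longrightarrow> br x y \<in> N"
    and r: "r + dim N = DIM('g)" and "q \<le> DIM('g)"
  shows "\<exists>e::nat \<Rightarrow> 'g. \<forall>i<q. e i \<bullet> e i = 1 \<and> (\<forall>j<i. e j \<bullet> e i = 0) \<and>
     (\<forall>x y. (\<forall>j<i. e j \<bullet> y = 0) \<longrightarrow> e i \<bullet> br x y = 0) \<and> (i < r \<longrightarrow> (\<forall>y\<in>N. e i \<bullet> y = 0))"
  using assms(5)
proof (induction q)
  case 0
  show ?case by simp
next
  case (Suc q)
  then obtain e :: "nat \<Rightarrow> 'g" where e: "\<And>i. i < q \<Longrightarrow> e i \<bullet> e i = 1 \<and> (\<forall>j<i. e j \<bullet> e i = 0) \<and>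
     (\<forall>x y. (\<forall>j<i. e j \<bullet> y = 0) \<longrightarrow> e i \<bullet> br x y = 0) \<and> (i < r \<longrightarrow> (\<forall>y\<in>N. e i \<bullet> y = 0))"
    by auto
  define I where "I = {x. \<forall>j<q. e j \<bullet> x = 0}"
  define N' where "N' = (if q < r then N else {0})"
  have N': "subspace N'" "\<And>x y. y \<in> N' \<Longrightarrow> br x y \<in> N'"
    using N by (auto simp: N'_def subspace_single_0 bilinear_rzero[OF bilinear_br])
  have subI: "subspace I" by (auto simp: I_def subspace_def inner_right_distrib)
  have "N' \<subseteq> I" using e by (auto simp: N'_def I_def)
  have brI: "br x y \<in> I" if "y \<in> I" for x y using that e by (auto simp: I_def)
  define I' where "I' = span ({br x y | x y. y \<in> I} \<union> N')"
  have "I' \<subseteq> I" unfolding I'_def using brI \<open>N' \<subseteq> I\<close> by (intro span_minimal subI) auto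
  have dimI: "DIM('g) \<le> dim I + q"
  proof -
    have "dim {y \<in> UNIV. \<forall>x\<in>span (e ` {..<q}). orthogonal x y} + dim (span (e ` {..<q})) = dim (UNIV :: 'g set)"
      by (intro dim_subspace_orthogonal_to_vectors) auto
    moreover have "dim {y \<in> UNIV. \<forall>x\<in>span (e ` {..<q}). orthogonal x y} \<le> dim I"
      by (intro dim_subset) (auto simp: I_def orthogonal_def intro: span_base)
    moreover have "dim (span (e ` {..<q})) \<le> q"
      using dim_le_card[of "e ` {..<q}" "e ` {..<q}"] card_image_le[of "{..<q}" e] by (simp add: span_superset)
    ultimately show ?thesis by simp
  qed
  have "I' \<noteq> I"
  proof
    assume "I' = I"
    obtain i where i: "lcs br i = {0}" using nil by (auto simp: nilpotent_lie_def)
    have "I \<subseteq> span (N' \<union> lcs br i)"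
      using \<open>I' = I\<close> by (intro lcs_absorbs[OF N']) (auto simp: I'_def)
    also have "\<dots> = N'"
      using N'(1) subspace_0[OF N'(1)] by (simp add: i insert_absorb span_eq_iff[THEN iffD2])
    finally have "dim I \<le> dim N'" by (rule dim_subset)
    moreover have "dim N' + q < DIM('g)" using Suc.prems r by (auto simp: N'_def)
    ultimately show False using dimI by linarith
  qed
  with \<open>I' \<subseteq> I\<close> have "span I' \<subset> span I"
    using subI by (auto simp: I'_def span_span span_eq_iff[THEN iffD2])
  then obtain v where v: "v \<noteq> 0" "v \<in> span I" "\<And>y. y \<in> span I' \<Longrightarrow> orthogonal v y"
    using orthogonal_to_subspace_exists_gen by blast
  define w where "w = v /\<^sub>R norm v"
  have w: "w \<in> I" "w \<bullet> w = 1" "\<And>y. y \<in> I' \<Longrightarrow> w \<bullet> y = 0"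
  proof -
    have "v \<in> I" using v(2) subI by (simp add: span_eq_iff[THEN iffD2])
    then show "w \<in> I" using subI by (simp add: w_def subspace_scale)
    show "w \<bullet> w = 1" using v(1) by (simp add: w_def dot_square_norm power2_eq_square)
    show "w \<bullet> y = 0" if "y \<in> I'" for y
      using v(3)[of y] span_base[OF that] by (simp add: w_def orthogonal_def)
  qed
  have "w \<bullet> br x y = 0" if "y \<in> I" for x y
    using that by (intro w(3)) (auto simp: I'_def intro!: span_base)
  moreover have "w \<bullet> y = 0" if "q < r" "y \<in> N" for y
    using that by (intro w(3)) (auto simp: I'_def N'_def intro!: span_base)
  ultimately have "\<forall>i<Suc q. (e(q := w)) i \<bullet> (e(q := w)) i = 1 \<and> (\<forall>j<i. (e(q := w)) j \<bullet> (e(q := w)) i = 0) \<and>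
     (\<forall>x y. (\<forall>j<i. (e(q := w)) j \<bullet> y = 0) \<longrightarrow> (e(q := w)) i \<bullet> br x y = 0) \<and>
     (i < r \<longrightarrow> (\<forall>y\<in>N. (e(q := w)) i \<bullet> y = 0))"
    using e w(1,2) by (auto simp: less_Suc_eq I_def)
  then show ?case by blast
qed

lemma flag_exists:
  assumes nil: "nilpotent_lie br" and N: "subspace N" "\<And>x y. y \<in> N \<Longrightarrow> br x y \<in> N"
    and r: "r + dim N = DIM('g)"
  obtains e :: "nat \<Rightarrow> 'g" where "flag_group (\<star>) br e DIM('g)" "N = {x. \<forall>j<r. e j \<bullet> x = 0}"
proof -
  obtain e :: "nat \<Rightarrow> 'g" where e: "\<And>i. i < DIM('g) \<Longrightarrow> e i \<bullet> e i = 1 \<and> (\<forall>j<i. e j \<bullet> e i = 0) \<and>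
     (\<forall>x y. (\<forall>j<i. e j \<bullet> y = 0) \<longrightarrow> e i \<bullet> br x y = 0) \<and> (i < r \<longrightarrow> (\<forall>y\<in>N. e i \<bullet> y = 0))"
    using flag_exists_aux[OF assms, of "DIM('g)"] by auto
  have orth: "e i \<bullet> e j = (if i = j then 1 else 0)" if "i < DIM('g)" "j < DIM('g)" for i j
    using e[OF that(1)] e[OF that(2)] by (cases i j rule: linorder_cases) (auto simp: inner_commute)
  have fg: "flag_group (\<star>) br e DIM('g)"
  proof
    fix i x y assume i: "i < DIM('g)" and y: "\<forall>j<i. e j \<bullet> y = 0"
    show "\<forall>j\<le>i. e j \<bullet> br x y = 0"
      using e y i by (meson dual_order.strict_trans1 order_le_less_trans less_le_trans)
  qed (use orth in auto)
  define I where "I = {x. \<forall>j<r. e j \<bullet> x = 0}"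
  have "N = I"
  proof (rule subspace_dim_equal)
    show "subspace I" by (auto simp: I_def subspace_def inner_right_distrib)
    show "N \<subseteq> I" using e r by (auto simp: I_def)
    have "inj_on e {..<r}"
      using orth r by (intro inj_onI) (metis lessThan_iff zero_neq_one trans_less_add1 less_le_trans le_add1)
    moreover have "pairwise orthogonal (e ` {..<r})"
      using orth r unfolding pairwise_def orthogonal_def by auto
    moreover have "e i \<noteq> 0" if "i < r" for i using orth[of i i] that r by auto
    then have "0 \<notin> e ` {..<r}" by force
    ultimately have "dim (e ` {..<r}) = r"
      by (simp add: dim_eq_card_independent pairwise_orthogonal_independent card_image)
    moreover have "dim {y \<in> UNIV. \<forall>x\<in>span (e ` {..<r}). orthogonal x y} + dim (span (e ` {..<r})) = dim (UNIV :: 'g set)"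
      by (intro dim_subspace_orthogonal_to_vectors) auto
    moreover have "dim I \<le> dim {y \<in> UNIV. \<forall>x\<in>span (e ` {..<r}). orthogonal x y}"
    proof (intro dim_subset, safe)
      fix y x assume y: "y \<in> I" "x \<in> span (e ` {..<r})"
      then have "orthogonal y x"
        by (intro orthogonal_to_span[of x "e ` {..<r}" y]) (auto simp: I_def orthogonal_def inner_commute)
      then show "orthogonal x y" by (simp add: orthogonal_commute)
    qed simp
    ultimately show "dim I \<le> dim N" using r by simp
  qed (rule N)
  with fg show ?thesis by (intro that) (auto simp: I_def)
qed

end

lemma J_basis_exists:
  fixes h :: "'g::euclidean_space set"
  assumes h: "subspace h" "dim h = 2 * n"
    and J_lin: "\<And>x y c. x \<in> h \<Longrightarrow> y \<in> h \<Longrightarrow> J (x + c *\<^sub>R y) = J x + c *\<^sub>R J y"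
    and J: "\<And>x. x \<in> h \<Longrightarrow> J x \<in> h" "\<And>x. x \<in> h \<Longrightarrow> J (J x) = - x"
  shows "\<exists>b::nat \<Rightarrow> 'g. span (b ` {..<n} \<union> (\<lambda>j. J (b j)) ` {..<n}) = h"
proof -
  define B where "B b r = b ` {..<r} \<union> (\<lambda>j. J (b j)) ` {..<r}" for b :: "nat \<Rightarrow> 'g" and r :: nat
  have J0: "J 0 = 0" using J_lin[of 0 0 1] subspace_0[OF h(1)] by simp
  have "\<exists>b. (\<forall>j<r. b j \<in> h) \<and> dim (B b r) = 2 * r" if "r \<le> n" for r
    using that
  proof (induction r)
    case 0
    then show ?case by (simp add: B_def)
  next
    case (Suc r)
    then obtain b where b: "\<And>j. j < r \<Longrightarrow> b j \<in> h" "dim (B b r) = 2 * r" by auto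
    have Bh: "B b r \<subseteq> h" using b J by (auto simp: B_def)
    then have sh: "span (B b r) \<subseteq> h" by (rule span_minimal[OF _ h(1)])
    have "x \<in> h \<and> J x \<in> span (B b r)" if "x \<in> span (B b r)" for x
      using that
    proof (induction rule: span_induct_alt)
      case base
      then show ?case by (simp add: J0 span_zero subspace_0[OF h(1)])
    next
      case (step c x y)
      have xy: "x \<in> h" "y \<in> h" using step Bh by auto
      have bB: "b j \<in> span (B b r)" "J (b j) \<in> span (B b r)" if "j < r" for j
        using that by (auto simp: B_def intro!: span_base)
      obtain j where j: "j < r" "x = b j \<or> x = J (b j)" using step(1) by (auto simp: B_def)
      have "J x \<in> span (B b r)"
        using j bB[OF j(1)] J(2)[OF b(1)[OF j(1)]] span_neg[OF bB(1)[OF j(1)]] by auto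
      then show ?case
        using step J_lin[OF xy(2,1), of c] xy h(1)
        by (simp add: add.commute span_add span_scale subspace_add subspace_scale)
    qed
    then have Jspan: "J x \<in> span (B b r)" if "x \<in> span (B b r)" for x using that by blast
    have "\<not> h \<subseteq> span (B b r)"
    proof
      assume "h \<subseteq> span (B b r)"
      then have "dim h \<le> dim (B b r)" using dim_subset[of h "span (B b r)"] by simp
      then show False using b(2) h(2) Suc.prems by simp
    qed
    then obtain x where x: "x \<in> h" "x \<notin> span (B b r)" by blast
    have Jx: "J x \<notin> span (insert x (B b r))"
    proof
      assume "J x \<in> span (insert x (B b r))"
      then obtain a where a: "J x - a *\<^sub>R x \<in> span (B b r)" by (auto simp: span_insert)
      define w where "w = J x - a *\<^sub>R x"
      have wh: "w \<in> h" using a sh by (auto simp: w_def)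
      have "J (w + a *\<^sub>R x) = J w + a *\<^sub>R J x" by (rule J_lin[OF wh x(1)])
      moreover have Jxw: "w + a *\<^sub>R x = J x" by (simp add: w_def)
      ultimately have "- x = J w + a *\<^sub>R (w + a *\<^sub>R x)" using J(2)[OF x(1)] by simp
      then have "- (J w + a *\<^sub>R w) = (1 + a * a) *\<^sub>R x"
        by (simp add: algebra_simps) (metis add.commute minus_add_cancel neg_eq_iff_add_eq_0 add.left_commute)
      moreover have "- (J w + a *\<^sub>R w) \<in> span (B b r)"
        using a Jspan by (intro span_neg span_add span_scale) (auto simp: w_def)
      ultimately have "(1 + a * a) *\<^sub>R x \<in> span (B b r)" by simp
      from span_scale[OF this, of "1 / (1 + a * a)"]
      have "((1 / (1 + a * a)) * (1 + a * a)) *\<^sub>R x \<in> span (B b r)" by (simp only: scaleR_scaleR)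
      moreover have "1 + a * a \<noteq> 0" by (metis add_pos_nonneg less_irrefl zero_le_square zero_less_one)
      ultimately show False using x(2) by simp
    qed
    have "B (b(r := x)) (Suc r) = insert (J x) (insert x (B b r))"
      by (auto simp: B_def lessThan_Suc)
    then have "dim (B (b(r := x)) (Suc r)) = 2 * Suc r"
      using Jx x(2) b(2) by (simp add: dim_insert)
    moreover have "\<forall>j<Suc r. (b(r := x)) j \<in> h" using b(1) x(1) by (auto simp: less_Suc_eq)
    ultimately show ?case by blast
  qed
  then obtain b where b: "\<forall>j<n. b j \<in> h" "dim (B b n) = 2 * n" by blast
  have "span (B b n) = h"
    using b J h by (intro subspace_dim_equal span_minimal subspace_span) (auto simp: B_def)
  then show ?thesis by (auto simp: B_def)
qed

lemma polyfun_sum: "finite I \<Longrightarrow> (\<And>i. i \<in> I \<Longrightarrow> f i \<in> polyfun V) \<Longrightarrow> (\<lambda>c. \<Sum>i\<in>I. f i c) \<in> polyfun V"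
  by (induction I rule: finite_induct) (auto intro: polyfun.intros)

context flag_group begin

lemma R_polyfun:
  assumes "f \<in> R"
  shows "(\<lambda>c. f (\<Sum>i<q. c i *\<^sub>R b i)) \<in> polyfun {..<q}"
  using assms unfolding A_def
proof (induction rule: alg_gen.induct)
  case (base f)
  then obtain j where "f = xc j" by auto
  then have "(\<lambda>c. f (\<Sum>i<q. c i *\<^sub>R b i)) = (\<lambda>c. \<Sum>i<q. of_real (e j \<bullet> b i) * complex_of_real (c i))"
    by (auto simp: xc_def inner_sum_right mult.commute)
  also have "\<dots> \<in> polyfun {..<q}"
    by (intro polyfun_sum polyfun.mul polyfun.const polyfun.var) auto
  finally show ?case .
qed (auto intro: polyfun.intros)

end

context cr_group begin

lemma dim_hj_le: "dim (hj i) \<le> dim (hj (Suc i)) + (if skipped i then 2 else 0)"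
proof (cases "skipped i")
  case False
  then have "hj i \<subseteq> hj (Suc i)" by (auto simp: hj_Suc skipped_def)
  then show ?thesis using dim_subset by (simp add: False)
next
  case True
  then obtain X where X: "X \<in> hj i" "mu i X \<noteq> 0" by (auto simp: skipped_def)
  have "hj i \<subseteq> span (insert X (insert (J X) (hj (Suc i))))" (is "_ \<subseteq> span ?B")
  proof
    fix Y assume Y: "Y \<in> hj i"
    define c where "c = mu i Y / mu i X"
    have "Y - csc c X \<in> span ?B"
      using hj_split[OF X Y] by (intro span_base) (simp add: c_def)
    moreover have "csc c X \<in> span ?B"
      unfolding csc_def by (intro span_diff span_scale span_base) auto
    ultimately show "Y \<in> span ?B" using span_add[of "Y - csc c X" ?B "csc c X"] by simp
  qed
  then have "dim (hj i) \<le> dim ?B" using dim_subset[of "hj i" "span ?B"] by simp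
  also have "\<dots> \<le> dim (hj (Suc i)) + 2" by (simp add: dim_insert)
  finally show ?thesis using True by simp
qed

lemma dim_hj_count: "dim h \<le> dim (hj i) + 2 * card {j. j < i \<and> skipped j}"
proof (induction i)
  case 0
  then show ?case by (simp add: hj_0)
next
  case (Suc i)
  have "{j. j < Suc i \<and> skipped j} = (if skipped i then insert i {j. j < i \<and> skipped j} else {j. j < i \<and> skipped j})"
    by (auto simp: less_Suc_eq)
  then show ?case using Suc dim_hj_le[of i] by (auto split: if_splits)
qed

lemma u_Inv: "i < q \<Longrightarrow> q \<le> m \<Longrightarrow> \<not> skipped i \<Longrightarrow> u i \<in> Inv (F q)"
proof (rule InvI)
  assume i: "i < q" "q \<le> m" "\<not> skipped i"
  then show "u i \<in> R" using RK_R u_RK by simp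
  fix w assume "w \<in> F q"
  then have "w \<in> F i" "e i \<bullet> w = 0" using i F_mono[of "Suc i" q] by (auto simp: F_Suc)
  then show "hat w (u i) = (\<lambda>_. 0)" using hat_u[of i w] i by simp
qed

lemma RK_CR_map: "(\<And>j. j < M \<Longrightarrow> \<iota> j \<in> RK) \<Longrightarrow> CR_map (\<star>) h J M \<iota>"
  unfolding CR_map_def
proof (intro allI ballI impI)
  fix j p X assume *: "\<And>j. j < M \<Longrightarrow> \<iota> j \<in> RK" "j < M" "X \<in> h"
  have "Zh X (\<iota> j) p = 0" using RK_zero[OF *(1)[OF *(2)] *(3)] by simp
  then show "\<exists>D. (\<iota> j has_derivative D) (at p) \<and> D (lvf (\<star>) X p) + \<i> * D (lvf (\<star>) (J X) p) = 0"
    using A_has_derivative[OF RK_R[OF *(1)[OF *(2)]], of p]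
    by (intro exI[of _ "frechet_derivative (\<iota> j) (at p)"]) (simp add: Zh_def hat_def Dv_def)
qed

lemma eq_via_coordinates:
  assumes "\<And>i. i < m \<Longrightarrow> e i \<bullet> p = e i \<bullet> q"
  shows "p = q"
proof -
  have "p = (\<Sum>j<m. (e j \<bullet> p) *\<^sub>R e j)" by (rule expand)
  also have "\<dots> = (\<Sum>j<m. (e j \<bullet> q) *\<^sub>R e j)" using assms by simp
  also have "\<dots> = q" by (rule expand[symmetric])
  finally show ?thesis .
qed

lemma embedding_of_generators:
  assumes \<iota>: "\<And>j. j < M \<Longrightarrow> \<iota> j \<in> RK" and gen: "u ` NS \<subseteq> \<iota> ` {..<M}"
  shows "embedding_Cm M \<iota>"
proof -
  let ?G = "\<iota> ` {..<M} \<union> (\<lambda>j p. cnj (\<iota> j p)) ` {..<M}"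
  have "u ` NS \<union> (\<lambda>j p. cnj (u j p)) ` NS \<subseteq> ?G"
  proof -
    have "(\<lambda>p. cnj (u i p)) \<in> (\<lambda>j p. cnj (\<iota> j p)) ` {..<M}" if i: "i \<in> NS" for i
    proof -
      obtain j where "j < M" "u i = \<iota> j" using gen i by blast
      then show ?thesis by auto
    qed
    then show ?thesis using gen by blast
  qed
  from alg_gen_mono[OF this] R_generated have RG: "R \<subseteq> alg_gen ?G" by blast
  have xG: "xc i \<in> alg_gen ?G" if "i < m" for i using RG xc_A[OF that] by blast
  have \<iota>R: "\<iota> j \<in> R" if "j < M" for j using \<iota>[OF that] by (rule RK_R)
  show ?thesis
    unfolding embedding_Cm_def
  proof (intro conjI allI impI)
    fix p q assume eq: "\<forall>j<M. \<iota> j p = \<iota> j q"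
    have "f p = f q" if "f \<in> alg_gen ?G" for f
      using that by induction (use eq in auto)
    from this[OF xG] show "p = q"
      by (intro eq_via_coordinates) (simp add: xc_def)
  next
    fix j p assume "j < M"
    then show "\<iota> j differentiable at p" using A_differentiable[OF \<iota>R] by simp
  next
    fix p D v assume D: "\<forall>j<M. (\<iota> j has_derivative D j) (at p)" and z: "\<forall>j<M. D j v = 0"
    have "\<exists>D. (f has_derivative D) (at p) \<and> D v = 0" if "f \<in> alg_gen ?G" for f
      using that
    proof induction
      case (const a)
      show ?case by (intro exI[of _ "\<lambda>_. 0"]) simp
    next
      case (base f)
      then obtain j where j: "j < M" "f = \<iota> j \<or> f = (\<lambda>p. cnj (\<iota> j p))" by auto
      then show ?case
        using D z has_derivative_cnj[of "\<iota> j" "D j" "at p"] by (metis complex_cnj_zero)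
    next
      case (add f g)
      then obtain D1 D2 where "(f has_derivative D1) (at p)" "(g has_derivative D2) (at p)" "D1 v = 0" "D2 v = 0"
        by blast
      then show ?case by (intro exI[of _ "\<lambda>x. D1 x + D2 x"]) (simp add: has_derivative_add)
    next
      case (mult f g)
      then obtain D1 D2 where "(f has_derivative D1) (at p)" "(g has_derivative D2) (at p)" "D1 v = 0" "D2 v = 0"
        by blast
      then show ?case
        by (intro exI[of _ "\<lambda>x. f p * D2 x + D1 x * g p"]) (simp add: has_derivative_mult)
    qed
    note ex = this
    have "e i \<bullet> v = e i \<bullet> 0" if i: "i < m" for i
    proof -
      obtain D where D: "(xc i has_derivative D) (at p)" "D v = 0" using ex[OF xG[OF i]] by blast
      have "(xc i has_derivative (\<lambda>v. complex_of_real (e i \<bullet> v))) (at p)"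
        unfolding xc_def[abs_def] by (auto intro!: derivative_eq_intros)
      from has_derivative_unique[OF D(1) this] D(2) show ?thesis by (metis inner_zero_right of_real_eq_0_iff)
    qed
    then show "v = 0" by (rule eq_via_coordinates)
  next
    fix a p assume lim: "\<forall>j<M. (\<lambda>i. \<iota> j (a i)) \<longlonglongrightarrow> \<iota> j p"
    have "(\<lambda>i. f (a i)) \<longlonglongrightarrow> f p" if "f \<in> alg_gen ?G" for f
      using that by induction (use lim in \<open>auto intro!: tendsto_intros\<close>)
    from this[OF xG] have x: "(\<lambda>i. e j \<bullet> a i) \<longlonglongrightarrow> e j \<bullet> p" if "j < m" for j
      using that tendsto_of_real_iff unfolding xc_def by blast
    have "(\<lambda>i. \<Sum>j<m. (e j \<bullet> a i) *\<^sub>R e j) \<longlonglongrightarrow> (\<Sum>j<m. (e j \<bullet> p) *\<^sub>R e j)"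
      using x by (intro tendsto_sum tendsto_scaleR tendsto_const) auto
    then show "a \<longlonglongrightarrow> p" by (simp only: expand[symmetric])
  qed
qed

end

theorem theorem1p1:
  fixes gmul br :: "'g::euclidean_space \<Rightarrow> 'g \<Rightarrow> 'g"
    and h N :: "'g set" and J :: "'g \<Rightarrow> 'g" and n k :: nat
  assumes "exp_coord_group gmul br"
    and "nilpotent_lie br"
    and "int_horizontal_CR br h N J n k"
  shows "\<exists>(b::nat \<Rightarrow> 'g) (P::nat \<Rightarrow> (nat \<Rightarrow> real) \<Rightarrow> complex) Q \<iota>.
           inj_on b {..<2*n+k} \<and> independent (b ` {..<2*n+k}) \<and>
           span (b ` {..<2*n}) = h \<and> span (b ` {2*n..<2*n+k}) = N \<and>
           (\<forall>j<n. J (b j) = b (n + j)) \<and>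
           (\<forall>j<n. P j \<in> polyfun {..<2*n}) \<and>
           (\<forall>l<k. Q l \<in> polyfun {..<2*n+k}) \<and>
           (\<forall>c. (\<forall>j<n. \<iota> j (\<Sum>i<2*n+k. c i *\<^sub>R b i) = Complex (c j) (c (n + j)) + P j c) \<and>
                (\<forall>l<k. \<iota> (n + l) (\<Sum>i<2*n+k. c i *\<^sub>R b i) = complex_of_real (c (2*n + l)) + Q l c)) \<and>
           CR_map gmul h J (n + k) \<iota> \<and> embedding_Cm (n + k) \<iota>"
proof -
  have h: "subspace h" "dim h = 2 * n" and N: "subspace N" "dim N = k" "\<And>x y. y \<in> N \<Longrightarrow> br x y \<in> N"
    and hN: "h \<inter> N = {0}" "{x + y | x y. x \<in> h \<and> y \<in> N} = UNIV"
    and J_lin: "\<And>x y c. x \<in> h \<Longrightarrow> y \<in> h \<Longrightarrow> J (x + c *\<^sub>R y) = J x + c *\<^sub>R J y"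
    and J: "\<And>x. x \<in> h \<Longrightarrow> J x \<in> h" "\<And>x. x \<in> h \<Longrightarrow> J (J x) = - x"
    and int: "\<And>X Y. X \<in> h \<Longrightarrow> Y \<in> h \<Longrightarrow> br X Y - br (J X) (J Y) \<in> h \<and>
        br X (J Y) + br (J X) Y = J (br X Y - br (J X) (J Y))"
    using assms(3) unfolding int_horizontal_CR_def by blast+
  have DIM: "DIM('g) = 2 * n + k"
    using dim_sums_Int[OF h(1) N(1)] hN h(2) N(2) by simp
  interpret exp_group gmul br by unfold_locales (rule assms(1))
  obtain e where "flag_group gmul br e DIM('g)" and Ne: "N = {x. \<forall>j<2*n. e j \<bullet> x = 0}"
    using flag_exists[OF assms(2) N(1,3), of "2 * n"] N(2) DIM by auto
  then interpret flag_group gmul br e "2 * n + k" by (simp add: DIM)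
  interpret cr_group gmul br e "2 * n + k" h J
    by unfold_locales (use h(1) J_lin J int in blast)+
  have NF: "F (2 * n) = N" by (simp add: Ne F_def)

  obtain b0 where b0: "span (b0 ` {..<n} \<union> (\<lambda>j. J (b0 j)) ` {..<n}) = h"
    using J_basis_exists[OF h J_lin J] by blast
  obtain BN where BN: "BN \<subseteq> N" "independent BN" "N \<subseteq> span BN" "card BN = k"
    using basis_exists[of N] N(2) by blast
  obtain bN where bN: "bij_betw bN {0..<k} BN"
    using ex_bij_betw_nat_finite[of BN] BN(4) independent_imp_finite[OF BN(2)] by blast
  define b where "b i = (if i < n then b0 i else if i < 2 * n then J (b0 (i - n)) else bN (i - 2 * n))" for i
  have "b ` {..<2*n} = b0 ` {..<n} \<union> (\<lambda>j. J (b0 j)) ` {..<n}"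
  proof -
    have "{..<2*n} = {..<n} \<union> {n..<n + n}" by auto
    also have "{n..<n + n} = (\<lambda>j. n + j) ` {..<n}"
      by (simp add: lessThan_atLeast0 image_add_atLeastLessThan)
    finally show ?thesis by (simp only: image_Un image_image) (auto simp: b_def)
  qed
  then have bh: "span (b ` {..<2*n}) = h" using b0 by simp
  have "b ` {2*n..<2*n+k} = BN"
  proof -
    have "{2*n..<2*n+k} = (\<lambda>j. 2 * n + j) ` {0..<k}"
      by (simp add: image_add_atLeastLessThan add.commute)
    then show ?thesis using bij_betw_imp_surj_on[OF bN] by (simp only: image_image) (simp add: b_def)
  qed
  then have bNs: "span (b ` {2*n..<2*n+k}) = N"
    using BN N(1) by (metis span_minimal subset_antisym)
  have "{..<2*n+k} = {..<2*n} \<union> {2*n..<2*n+k}" by auto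
  then have "span (b ` {..<2*n+k}) = {x + y | x y. x \<in> span (b ` {..<2*n}) \<and> y \<in> span (b ` {2*n..<2*n+k})}"
    by (simp only: image_Un span_Un)
  then have bU: "span (b ` {..<2*n+k}) = UNIV" using hN(2) bh bNs by simp
  have card_le: "card (b ` {..<2*n+k}) \<le> 2 * n + k" using card_image_le[of "{..<2*n+k}" b] by simp
  have ind: "independent (b ` {..<2*n+k})"
    using card_le DIM bU by (intro card_le_dim_spanning[of _ UNIV]) auto
  then have "card (b ` {..<2*n+k}) = 2 * n + k"
    using bU DIM by (metis dim_UNIV dim_eq_card_independent dim_span)
  then have inj: "inj_on b {..<2*n+k}" by (intro eq_card_imp_inj_on) auto

  define A0 where "A0 = {i. i < 2 * n \<and> \<not> skipped i}"
  have "hj (2 * n) = {0}"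
  proof -
    have "hj (2 * n) \<subseteq> h \<inter> N" unfolding hj_def NF by blast
    then show ?thesis using hN(1) subspace_0[OF subspace_hj, of "2 * n"] by blast
  qed
  then have "n \<le> card {j. j < 2 * n \<and> skipped j}"
    using dim_hj_count[of "2 * n"] h(2) by simp
  moreover have "card A0 + card {j. j < 2 * n \<and> skipped j} = 2 * n"
  proof -
    have "A0 \<union> {j. j < 2 * n \<and> skipped j} = {..<2 * n}" by (auto simp: A0_def)
    moreover have "card (A0 \<union> {j. j < 2 * n \<and> skipped j}) = card A0 + card {j. j < 2 * n \<and> skipped j}"
      by (intro card_Un_disjoint) (auto simp: A0_def)
    ultimately show ?thesis by simp
  qed
  ultimately have cA: "card A0 \<le> n" by simp
  obtain en where en: "bij_betw en {0..<card A0} A0"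
    using ex_bij_betw_nat_finite[of A0] by (auto simp: A0_def)
  \<comment> \<open>At most \<open>n\<close> steps below \<open>2 * n\<close> are not skipped; missing components are padded with 0.\<close>
  define \<iota> where "\<iota> j = (if j < n then (if j < card A0 then u (en j) else (\<lambda>_. 0))
      else if skipped (n + j) then (\<lambda>_. 0) else u (n + j))" for j
  have enA: "en j \<in> A0" if "j < card A0" for j using bij_betwE[OF en] that by auto
  have zRK: "(\<lambda>_. 0) \<in> RK" by (rule subalg_const[OF subalg_RK])
  have \<iota>RK: "\<iota> j \<in> RK" if "j < n + k" for j
  proof -
    have "u (en j) \<in> RK" if "j < card A0"
      using u_RK[of "en j"] enA[OF that] by (simp add: A0_def)
    then show ?thesis using zRK u_RK[of "n + j"] that by (simp add: \<iota>_def)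
  qed
  have "u ` NS \<subseteq> \<iota> ` {..<n + k}"
  proof
    fix f assume "f \<in> u ` NS"
    then obtain i where i: "f = u i" "i < 2 * n + k" "\<not> skipped i" by blast
    show "f \<in> \<iota> ` {..<n + k}"
    proof (cases "i < 2 * n")
      case True
      then have "i \<in> A0" using i by (simp add: A0_def)
      then obtain j where j: "j < card A0" "en j = i"
        using bij_betw_imp_surj_on[OF en] by (metis atLeastLessThan_iff imageE)
      then have "f = \<iota> j" "j < n + k" using cA i by (simp_all add: \<iota>_def)
      then show ?thesis by blast
    next
      case False
      then have "f = \<iota> (i - n)" "i - n < n + k" using i by (auto simp: \<iota>_def)
      then show ?thesis by blast
    qed
  qed
  note emb = embedding_of_generators[OF \<iota>RK this]

  define P where "P j c = \<iota> j (\<Sum>i<2*n+k. c i *\<^sub>R b i) - Complex (c j) (c (n + j))" for j and c :: "nat \<Rightarrow> real"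
  define Q where "Q l c = \<iota> (n + l) (\<Sum>i<2*n+k. c i *\<^sub>R b i) - complex_of_real (c (2*n + l))" for l and c :: "nat \<Rightarrow> real"
  have minus: "(\<lambda>c. f c - g c) \<in> polyfun V" if "f \<in> polyfun V" "g \<in> polyfun V" for f g V
    using polyfun.add[OF that(1) polyfun.mul[OF polyfun.const[of "-1"] that(2)]] by simp
  have "P j \<in> polyfun {..<2*n}" if j: "j < n" for j
  proof -
    have inv: "\<iota> j \<in> Inv (F (2 * n))"
    proof -
      have "u (en j) \<in> Inv (F (2 * n))" if "j < card A0"
        using u_Inv[of "en j" "2 * n"] enA[OF that] by (simp add: A0_def)
      then show ?thesis using j subalg_const[OF subalg_Inv, of 0] by (simp add: \<iota>_def)
    qed
    have "\<iota> j (\<Sum>i<2*n+k. c i *\<^sub>R b i) = \<iota> j (\<Sum>i<2*n. c i *\<^sub>R b i)" for c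
    proof -
      have "(\<Sum>i<2*n+k. c i *\<^sub>R b i) = (\<Sum>i<2*n. c i *\<^sub>R b i) + (\<Sum>i=2*n..<2*n+k. c i *\<^sub>R b i)"
        using sum.atLeastLessThan_concat[of 0 "2*n" "2*n+k" "\<lambda>i. c i *\<^sub>R b i"] by (simp add: atLeast0LessThan)
      moreover have "(\<Sum>i=2*n..<2*n+k. c i *\<^sub>R b i) \<in> F (2 * n)"
        unfolding NF bNs[symmetric] by (intro span_sum span_scale span_base) auto
      ultimately show ?thesis
        using hat_zero_invariant[OF Inv_R[OF inv] Inv_zero[OF inv]] by simp
    qed
    then have "(\<lambda>c. \<iota> j (\<Sum>i<2*n+k. c i *\<^sub>R b i)) \<in> polyfun {..<2*n}"
      using R_polyfun[OF Inv_R[OF inv], of b "2 * n"] by simp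
    moreover have "(\<lambda>c. Complex (c j) (c (n + j))) \<in> polyfun {..<2*n}"
      unfolding Complex_eq using j by (intro polyfun.intros) auto
    ultimately show ?thesis unfolding P_def[abs_def] by (rule minus)
  qed
  moreover have "Q l \<in> polyfun {..<2*n+k}" if l: "l < k" for l
    unfolding Q_def[abs_def] using l RK_R[OF \<iota>RK]
    by (intro minus polyfun.var R_polyfun) auto
  moreover have "J (b j) = b (n + j)" if "j < n" for j
    using that by (simp add: b_def)
  ultimately show ?thesis
    using inj ind bh bNs emb RK_CR_map[OF \<iota>RK]
    by (intro exI[of _ b] exI[of _ P] exI[of _ Q] exI[of _ \<iota>]) (auto simp: P_def Q_def)
qed

end
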